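(* Let $p$ be a prime, let $H\cong 2\cdot \mathrm{S}_4$ be a subgroup of $\mathrm{SL}(2,p)$, let $x\in\mathrm{SL}(2,p)$, and let $S$ be either the $H$-plus-two subset $H\cup\{x,x^{-1}\}$ or, when $x^2\in H$, the $H$ plus coset core $H\cup(xH\cap Hx)$, with $\langle S\rangle=\mathrm{SL}(2,p)$. Then $|S^3|\ge 224$ and $|S|\le 64$, giving $|S^3|\ge|S|^{1+\delta}$ for $\delta=(\log_2(7)-1)/6$. Furthermore, $|S^3|=|S|^{1+\delta}$ if and only if $L=x^{-1}Hx\cap H$ has index $3$ in $H$ and $S=H\cup xL$ with $x^2\in H$.
   Context: For a subset $S$ of a group, $S^3=\{abc: a,b,c\in S\}$. Here $2\cdot\mathrm{S}_4$ denotes the binary octahedral group of order 48, i.e. the double cover of $\mathrm{S}_4$ occurring as the full preimage in $\mathrm{SL}(2,p)$ of a subgroup $\mathrm{S}_4$ of $\mathrm{PSL}(2,p)$. For $x$ with $x^2\in H$ one has $xH\cap Hx = xL$ with $L=x^{-1}Hx\cap H$. *)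

theory Defs
  imports
    "HOL-Analysis.Analysis"
    "HOL-Algebra.Algebra"
    "Berlekamp_Zassenhaus.Finite_Field"
begin

text \<open>
  The prime \<open>p\<close> is the cardinality of the type \<open>'p\<close> of class \<open>prime_card\<close>, and
  \<open>'p mod_ring\<close> is the field of integers modulo \<open>p\<close>.
\<close>

definition SL2 :: "('p::prime_card mod_ring ^ 2 ^ 2) monoid" where
  "SL2 = \<lparr>carrier = {A. det A = 1}, mult = (**), one = mat 1\<rparr>"

definition SL2_scalars :: "('p::prime_card mod_ring ^ 2 ^ 2) set" where
  "SL2_scalars = {mat 1, - mat 1}"

definition PSL2 :: "('p::prime_card mod_ring ^ 2 ^ 2) set monoid" where
  "PSL2 = SL2 Mod SL2_scalars"

lemma group_SL2: "group (SL2 :: ('p::prime_card mod_ring ^ 2 ^ 2) monoid)"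
proof (rule groupI)
  fix A :: "'p mod_ring ^ 2 ^ 2"
  assume "A \<in> carrier SL2"
  then have d: "A$1$1 * A$2$2 - A$1$2 * A$2$1 = 1"
    by (simp add: SL2_def det_2)
  define B :: "'p mod_ring ^ 2 ^ 2" where
    "B = (\<chi> i j. if i = 1 then (if j = 1 then A$2$2 else - A$1$2)
                 else (if j = 1 then - A$2$1 else A$1$1))"
  have "det B = 1"
    using d by (simp add: B_def det_2 mult.commute)
  moreover have "B ** A = mat 1"
    using d by (simp add: B_def vec_eq_iff forall_2 matrix_matrix_mult_def sum_2 mat_def algebra_simps)
  ultimately show "\<exists>B\<in>carrier SL2. B \<otimes>\<^bsub>SL2\<^esub> A = \<one>\<^bsub>SL2\<^esub>"
    by (auto simp: SL2_def)
qed (auto simp: SL2_def det_mul matrix_mul_assoc)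

lemma normal_SL2_scalars:
  "(SL2_scalars :: ('p::prime_card mod_ring ^ 2 ^ 2) set) \<lhd> SL2"
proof -
  interpret group "SL2 :: ('p mod_ring ^ 2 ^ 2) monoid" by (rule group_SL2)
  have neg: "(- mat 1 :: 'p mod_ring ^ 2 ^ 2) ** A = - A"
            "A ** (- mat 1 :: 'p mod_ring ^ 2 ^ 2) = - A" for A
    by (simp_all add: vec_eq_iff forall_2 matrix_matrix_mult_def sum_2 mat_def)
  have sub: "(SL2_scalars :: ('p mod_ring ^ 2 ^ 2) set) \<subseteq> carrier SL2"
    by (auto simp: SL2_scalars_def SL2_def det_2 mat_def)
  have neg_neg: "(- mat 1) \<otimes>\<^bsub>SL2\<^esub> (- mat 1) = (\<one>\<^bsub>SL2\<^esub> :: 'p mod_ring ^ 2 ^ 2)"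
    by (simp add: SL2_def neg)
  have "subgroup SL2_scalars (SL2 :: ('p mod_ring ^ 2 ^ 2) monoid)"
  proof (rule subgroupI[OF sub])
    fix a :: "'p mod_ring ^ 2 ^ 2" assume a: "a \<in> SL2_scalars"
    have "a \<otimes>\<^bsub>SL2\<^esub> a = \<one>\<^bsub>SL2\<^esub>"
      using a neg_neg by (auto simp: SL2_scalars_def SL2_def)
    then show "inv\<^bsub>SL2\<^esub> a \<in> SL2_scalars"
      using a sub inv_equality by fastforce
  qed (auto simp: SL2_scalars_def SL2_def neg)
  moreover have "SL2_scalars #>\<^bsub>SL2\<^esub> A = A <#\<^bsub>SL2\<^esub> SL2_scalars" for A :: "'p mod_ring ^ 2 ^ 2"
    by (auto simp: r_coset_def l_coset_def SL2_scalars_def SL2_def neg)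
  ultimately show ?thesis
    by (auto intro: normalI)
qed

definition PSL2_preimage ::
  "('p::prime_card mod_ring ^ 2 ^ 2) set set \<Rightarrow> ('p mod_ring ^ 2 ^ 2) set" where
  "PSL2_preimage T = {g \<in> carrier SL2. SL2_scalars #>\<^bsub>SL2\<^esub> g \<in> T}"

text \<open>
  The subgroup \<open>H\<close> is isomorphic to \<open>2\<cdot>S\<^sub>4\<close>, the binary octahedral group. The latter is taken
  to be the double cover of \<open>S\<^sub>4\<close> that arises as the full preimage in \<open>SL(2,p)\<close> of a subgroup
  \<open>S\<^sub>4\<close> of \<open>PSL(2,p)\<close>; this excludes the other double covers of \<open>S\<^sub>4\<close>, such as \<open>GL(2,3)\<close>.
\<close>

definition iso_2S4 :: "('p::prime_card mod_ring ^ 2 ^ 2) set \<Rightarrow> bool" where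
  "iso_2S4 H \<longleftrightarrow>
     (\<exists>T :: ('p mod_ring ^ 2 ^ 2) set set. subgroup T PSL2 \<and> PSL2\<lparr>carrier := T\<rparr> \<cong> sym_group 4 \<and>
          SL2\<lparr>carrier := H\<rparr> \<cong> SL2\<lparr>carrier := PSL2_preimage T\<rparr>)"

definition set_cube :: "('a, 'b) monoid_scheme \<Rightarrow> 'a set \<Rightarrow> 'a set" where
  "set_cube G S = {a \<otimes>\<^bsub>G\<^esub> b \<otimes>\<^bsub>G\<^esub> c | a b c. a \<in> S \<and> b \<in> S \<and> c \<in> S}"

definition plus_two_subset :: "('a, 'b) monoid_scheme \<Rightarrow> 'a set \<Rightarrow> 'a \<Rightarrow> 'a set" where
  "plus_two_subset G H x = H \<union> {x, inv\<^bsub>G\<^esub> x}"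

definition plus_coset_core :: "('a, 'b) monoid_scheme \<Rightarrow> 'a set \<Rightarrow> 'a \<Rightarrow> 'a set" where
  "plus_coset_core G H x = H \<union> ((x <#\<^bsub>G\<^esub> H) \<inter> (H #>\<^bsub>G\<^esub> x))"

definition conj_inter :: "('a, 'b) monoid_scheme \<Rightarrow> 'a set \<Rightarrow> 'a \<Rightarrow> 'a set" where
  "conj_inter G H x = ((inv\<^bsub>G\<^esub> x <#\<^bsub>G\<^esub> H) #>\<^bsub>G\<^esub> x) \<inter> H"

definition subgroup_index :: "('a, 'b) monoid_scheme \<Rightarrow> 'a set \<Rightarrow> 'a set \<Rightarrow> nat" where
  "subgroup_index G H L = card (rcosets\<^bsub>G\<lparr>carrier := H\<rparr>\<^esub> L)"

end

theory Submission
  imports Defs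
begin

text \<open>
  Only two features of the configuration matter: the order of \<open>H\<close>, which is 48, and the shortage of
  normal subgroups in \<open>G = SL(2,p)\<close>. Let \<open>L = x\<^sup>-\<^sup>1Hx \<inter> H\<close> and let \<open>k\<close> be its index in \<open>H\<close>.
  In both cases \<open>S\<close> contains \<open>H\<close>, \<open>x\<close> and \<open>x\<^sup>-\<^sup>1\<close>, so \<open>S\<^sup>3\<close> contains \<open>H\<close>, \<open>HxH\<close>, \<open>Hx\<^sup>-\<^sup>1H\<close> and
  \<open>xHx\<close>. Since \<open>HxH\<close> has \<open>48k\<close> elements, \<open>H \<union> HxH\<close> alone gives at least 240 when \<open>k \<ge> 4\<close>.

  For \<open>k = 1\<close> the generators \<open>H\<close> and \<open>x\<close> of \<open>G\<close> normalise \<open>H\<close>, which would be a normal subgroup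
  of order 48. For \<open>k = 2, 3\<close> the bound is also clear if \<open>HxH \<noteq> Hx\<^sup>-\<^sup>1H\<close>; otherwise some
  \<open>y \<in> xH\<close> has \<open>y\<^sup>2 \<in> H\<close>, and then \<open>y\<close> normalises \<open>L' = y\<^sup>-\<^sup>1Hy \<inter> H\<close>, so that \<open>L'\<close> is not normal
  in \<open>H\<close>, for otherwise it would be normal in \<open>G\<close>. This excludes \<open>k = 2\<close>. For \<open>k = 3\<close> it makes
  \<open>H - L'\<close> a single double coset of \<open>L'\<close>. If one element of \<open>y(H - L')y\<close> lay in \<open>HyH\<close>, then all
  would, and \<open>H \<union> HyH\<close> would be a group, that is, all of \<open>G\<close>, of order 192, whereas
  \<open>p(p\<^sup>2 - 1) \<ge> 336\<close>. Hence \<open>H\<close>, \<open>HyH\<close> and \<open>y(H - L')y\<close> are disjoint. They have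
  \<open>48 + 144 + 32 = 224\<close> elements, and \<open>S\<^sup>3\<close> contains a translate of their union
  (\<open>card_index_3_products\<close>, \<open>card_set_cube_ge\<close>).

  When \<open>x\<^sup>2 \<in> H\<close> the same normality argument gives \<open>k \<ge> 3\<close>, so
  \<open>\<bar>H \<union> xL\<bar> \<le> 48 + 16 = 64\<close>, while \<open>H \<union> {x, x\<^sup>-\<^sup>1}\<close> has at most 50 elements, and
  \<open>64\<^sup>1\<^sup>+\<^sup>\<delta> = 224\<close>. Equality therefore forces \<open>\<bar>S\<bar> = 64\<close>, that is, \<open>S = H \<union> xL\<close> with \<open>k = 3\<close>; conversely the cube of this set lies in
  \<open>H \<union> HxH \<union> x(H - L)x\<close> and so has at most 224 elements (\<open>card_set_cube_le\<close>).

  On the side of \<open>SL(2,p)\<close>, the divisibility of \<open>p(p\<^sup>2 - 1)\<close> by the order of \<open>H\<close> gives \<open>p \<ge> 7\<close>. A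
  normal subgroup with more than two elements is not central, so taking commutators produces a
  nontrivial unipotent matrix in it, and \<open>p\<close> divides its order. Hence no normal subgroup has order
  16, 24 or 48.
\<close>

section \<open>Double cosets in a finite group\<close>

text \<open>Together with \<open>m_assoc\<close> and \<open>inv_mult_group\<close> these rules make the simplifier decide
  equations between group words.\<close>

lemma (in group) inv_cancel_left:
  assumes "x \<in> carrier G" "y \<in> carrier G"
  shows "inv x \<otimes> (x \<otimes> y) = y" "x \<otimes> (inv x \<otimes> y) = y"
  using assms by (simp_all flip: m_assoc)

definition double_coset :: "('a, 'b) monoid_scheme \<Rightarrow> 'a set \<Rightarrow> 'a \<Rightarrow> 'a set" where
  "double_coset G K x = {a \<otimes>\<^bsub>G\<^esub> x \<otimes>\<^bsub>G\<^esub> b | a b. a \<in> K \<and> b \<in> K}"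

lemma double_cosetI:
  "a \<in> K \<Longrightarrow> b \<in> K \<Longrightarrow> a \<otimes>\<^bsub>G\<^esub> x \<otimes>\<^bsub>G\<^esub> b \<in> double_coset G K x"
  by (auto simp: double_coset_def)

lemma double_cosetE:
  assumes "y \<in> double_coset G K x"
  obtains a b where "a \<in> K" "b \<in> K" "y = a \<otimes>\<^bsub>G\<^esub> x \<otimes>\<^bsub>G\<^esub> b"
  using assms by (auto simp: double_coset_def)

lemma set_cubeI:
  "a \<in> S \<Longrightarrow> b \<in> S \<Longrightarrow> c \<in> S \<Longrightarrow> a \<otimes>\<^bsub>G\<^esub> b \<otimes>\<^bsub>G\<^esub> c \<in> set_cube G S"
  by (auto simp: set_cube_def)

context group
begin

lemma mem_conj_inter_iff:
  assumes "subgroup K G" "x \<in> carrier G"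
  shows "l \<in> conj_inter G K x \<longleftrightarrow> l \<in> K \<and> x \<otimes> l \<otimes> inv x \<in> K"
proof -
  interpret K: subgroup K G by fact
  have eq: "inv x \<otimes> (x \<otimes> l \<otimes> inv x) \<otimes> x = l" if "l \<in> carrier G" for l
    using that assms(2) by (simp add: m_assoc inv_cancel_left)
  have eq': "x \<otimes> (inv x \<otimes> k \<otimes> x) \<otimes> inv x = k" if "k \<in> carrier G" for k
    using that assms(2) by (simp add: m_assoc inv_cancel_left)
  have "l \<in> (inv x <# K) #> x \<longleftrightarrow> (\<exists>k\<in>K. l = inv x \<otimes> k \<otimes> x)"
    by (auto simp: l_coset_def r_coset_def)
  also have "\<dots> \<longleftrightarrow> x \<otimes> l \<otimes> inv x \<in> K" if "l \<in> K"
    using eq eq' that K.mem_carrier by metis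
  finally show ?thesis by (auto simp: conj_inter_def)
qed

lemma subgroup_conj_inter:
  assumes "subgroup K G" "x \<in> carrier G"
  shows "subgroup (conj_inter G K x) G"
proof -
  interpret K: subgroup K G by fact
  show ?thesis
  proof (rule subgroupI)
    show "conj_inter G K x \<subseteq> carrier G" by (auto simp: conj_inter_def)
    have "\<one> \<in> conj_inter G K x" using assms by (simp add: mem_conj_inter_iff)
    then show "conj_inter G K x \<noteq> {}" by auto
  next
    fix a assume "a \<in> conj_inter G K x"
    then have a: "a \<in> K" "x \<otimes> a \<otimes> inv x \<in> K" using assms by (auto simp: mem_conj_inter_iff)
    have "inv (x \<otimes> a \<otimes> inv x) = x \<otimes> inv a \<otimes> inv x"
      using a(1) assms(2) by (simp add: inv_mult_group m_assoc)
    then show "inv a \<in> conj_inter G K x"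
      using a assms K.m_inv_closed[OF a(2)] by (simp add: mem_conj_inter_iff)
  next
    fix a b assume "a \<in> conj_inter G K x" "b \<in> conj_inter G K x"
    then have a: "a \<in> K" "x \<otimes> a \<otimes> inv x \<in> K" and b: "b \<in> K" "x \<otimes> b \<otimes> inv x \<in> K"
      using assms by (auto simp: mem_conj_inter_iff)
    have "(x \<otimes> a \<otimes> inv x) \<otimes> (x \<otimes> b \<otimes> inv x) = x \<otimes> (a \<otimes> b) \<otimes> inv x"
      using a(1) b(1) assms(2) by (simp add: m_assoc inv_cancel_left)
    then show "a \<otimes> b \<in> conj_inter G K x"
      using a b assms K.m_closed[OF a(2) b(2)] by (simp add: mem_conj_inter_iff)
  qed
qed

text \<open>The map \<open>(a, b) \<mapsto> a x b\<close> from \<open>K \<times> K\<close> onto \<open>KxK\<close> has all fibres of the same size: the fibre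
  through \<open>(a, b)\<close> consists of the pairs \<open>(a x l\<^sup>-\<^sup>1 x\<^sup>-\<^sup>1, l b)\<close> with \<open>l \<in> K \<inter> x\<^sup>-\<^sup>1Kx\<close>.\<close>

lemma card_double_coset:
  assumes fin: "finite (carrier G)" and K: "subgroup K G" and x: "x \<in> carrier G"
  shows "card (double_coset G K x) * card (conj_inter G K x) = card K * card K"
proof -
  interpret K: subgroup K G by fact
  let ?L = "conj_inter G K x" and ?f = "\<lambda>(a, b). a \<otimes> x \<otimes> b"
  have finK: "finite K" using fin K.subset finite_subset by blast
  have img: "?f ` (K \<times> K) = double_coset G K x"
    by (auto simp: double_coset_def)
  have fibre: "card {z \<in> K \<times> K. ?f z = y} = card ?L" if y: "y \<in> ?f ` (K \<times> K)" for y
  proof -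
    obtain a b where ab: "a \<in> K" "b \<in> K" "y = a \<otimes> x \<otimes> b" using y by auto
    let ?g = "\<lambda>l. (a \<otimes> (x \<otimes> inv l \<otimes> inv x), l \<otimes> b)"
    have "bij_betw ?g ?L {z \<in> K \<times> K. ?f z = y}"
    proof (rule bij_betw_imageI)
      show "inj_on ?g ?L"
        using ab by (auto simp: inj_on_def conj_inter_def)
      show "?g ` ?L = {z \<in> K \<times> K. ?f z = y}"
      proof (intro equalityI subsetI)
        fix z assume "z \<in> ?g ` ?L"
        then obtain l where l: "l \<in> ?L" "z = ?g l" by auto
        have il: "inv l \<in> ?L" and lK: "l \<in> K"
          using l(1) subgroup.m_inv_closed[OF subgroup_conj_inter[OF K x]]
          by (auto simp: conj_inter_def)
        have "a \<otimes> (x \<otimes> inv l \<otimes> inv x) \<otimes> x \<otimes> (l \<otimes> b) = a \<otimes> x \<otimes> b"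
          using lK ab x by (simp add: m_assoc inv_cancel_left)
        then show "z \<in> {z \<in> K \<times> K. ?f z = y}"
          using il lK l(2) ab K x by (simp add: mem_conj_inter_iff)
      next
        fix z assume "z \<in> {z \<in> K \<times> K. ?f z = y}"
        then obtain a' b' where z: "z = (a', b')" "a' \<in> K" "b' \<in> K" "a' \<otimes> x \<otimes> b' = a \<otimes> x \<otimes> b"
          using ab by auto
        let ?l = "b' \<otimes> inv b"
        have c: "a \<in> carrier G" "b \<in> carrier G" "a' \<in> carrier G" "b' \<in> carrier G"
          using z(2,3) ab(1,2) by simp_all
        have "x \<otimes> ?l = inv a' \<otimes> (a' \<otimes> x \<otimes> b') \<otimes> inv b"
          using c x by (simp add: m_assoc inv_cancel_left)
        also have "\<dots> = inv a' \<otimes> a \<otimes> x"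
          unfolding z(4) using c x by (simp add: m_assoc)
        finally have xl: "x \<otimes> ?l = inv a' \<otimes> a \<otimes> x" .
        have c1: "x \<otimes> ?l \<otimes> inv x = inv a' \<otimes> a"
          unfolding xl using c x by (simp add: m_assoc)
        have l: "?l \<in> ?L" using K x z(2,3) ab(1,2) c1 by (simp add: mem_conj_inter_iff)
        have "x \<otimes> inv ?l \<otimes> inv x = inv (x \<otimes> ?l \<otimes> inv x)"
          using c x by (simp add: m_assoc inv_mult_group)
        also have "\<dots> = inv a \<otimes> a'" unfolding c1 using c by (simp add: inv_mult_group)
        finally have gl: "?g ?l = (a', b')"
          using c x by (simp add: m_assoc inv_cancel_left)
        show "z \<in> ?g ` ?L" unfolding z(1) by (rule image_eqI[of _ ?g ?l, OF gl[symmetric] l])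
      qed
    qed
    then show ?thesis by (simp add: bij_betw_same_card)
  qed
  have "card (K \<times> K) = (\<Sum>y\<in>?f ` (K \<times> K). card {z \<in> K \<times> K. ?f z = y})"
    using sum.image_gen[of "K \<times> K" "\<lambda>_. 1::nat" ?f] finK by simp
  also have "\<dots> = (\<Sum>y\<in>?f ` (K \<times> K). card ?L)"
    by (rule sum.cong) (use fibre in auto)
  finally show ?thesis unfolding img by (simp add: card_cartesian_product)
qed

lemma double_coset_mult_closed:
  assumes "subgroup K G" "x \<in> carrier G" "y \<in> double_coset G K x" "k \<in> K"
  shows "y \<otimes> k \<in> double_coset G K x" "k \<otimes> y \<in> double_coset G K x"
proof -
  interpret K: subgroup K G by fact
  obtain a b where ab: "a \<in> K" "b \<in> K" "y = a \<otimes> x \<otimes> b" using assms(3) by (rule double_cosetE)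
  have "y \<otimes> k = a \<otimes> x \<otimes> (b \<otimes> k)" "k \<otimes> y = (k \<otimes> a) \<otimes> x \<otimes> b"
    using ab assms by (simp_all add: m_assoc)
  then show "y \<otimes> k \<in> double_coset G K x" "k \<otimes> y \<in> double_coset G K x"
    using ab assms(4) by (auto intro!: double_cosetI)
qed

lemma double_coset_subset_carrier:
  assumes "subgroup K G" "x \<in> carrier G"
  shows "double_coset G K x \<subseteq> carrier G"
proof -
  interpret K: subgroup K G by fact
  show ?thesis using assms by (auto simp: double_coset_def)
qed

lemma mem_double_coset_self:
  assumes "subgroup K G" "x \<in> carrier G"
  shows "x \<in> double_coset G K x"
proof -
  interpret K: subgroup K G by fact
  show ?thesis using double_cosetI[of \<one> K \<one> G x] assms by simp
qed

lemma mem_double_coset_sym: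
  assumes "subgroup K G" "x \<in> carrier G" "y \<in> double_coset G K x"
  shows "x \<in> double_coset G K y"
proof -
  interpret K: subgroup K G by fact
  obtain a b where ab: "a \<in> K" "b \<in> K" "y = a \<otimes> x \<otimes> b" using assms(3) by (rule double_cosetE)
  have "inv a \<otimes> y \<otimes> inv b = x" using ab assms(2) by (simp add: m_assoc inv_cancel_left)
  moreover have "inv a \<otimes> y \<otimes> inv b \<in> double_coset G K y" using ab(1,2) by (simp add: double_cosetI)
  ultimately show ?thesis by simp
qed

lemma double_coset_eq:
  assumes K: "subgroup K G" and x: "x \<in> carrier G" and y: "y \<in> double_coset G K x"
  shows "double_coset G K y = double_coset G K x"
proof -
  have sub: "double_coset G K v \<subseteq> double_coset G K u"
    if "u \<in> carrier G" "v \<in> double_coset G K u" for u v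
  proof
    fix z assume "z \<in> double_coset G K v"
    then obtain a b where "a \<in> K" "b \<in> K" "z = a \<otimes> v \<otimes> b" by (rule double_cosetE)
    then show "z \<in> double_coset G K u"
      using double_coset_mult_closed[OF K that(1)] that(2) by metis
  qed
  have "y \<in> carrier G" using y double_coset_subset_carrier[OF K x] by auto
  then show ?thesis using sub[OF x y] sub mem_double_coset_sym[OF K x y] by blast
qed

lemma double_coset_disjoint:
  assumes "subgroup K G" "x \<in> carrier G" "y \<in> carrier G" "y \<notin> double_coset G K x"
  shows "double_coset G K x \<inter> double_coset G K y = {}"
proof (rule ccontr)
  assume "\<not> ?thesis"
  then obtain z where "z \<in> double_coset G K x" "z \<in> double_coset G K y" by auto
  then have "double_coset G K y = double_coset G K x"
    using double_coset_eq assms by metis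
  then show False using mem_double_coset_self[of K y] assms by simp
qed

lemma subgroup_disjoint_double_coset:
  assumes "subgroup K G" "x \<in> carrier G" "x \<notin> K"
  shows "K \<inter> double_coset G K x = {}"
proof -
  interpret K: subgroup K G by fact
  have "x \<in> K" if z: "z \<in> K" "z \<in> double_coset G K x" for z
  proof -
    obtain a b where ab: "a \<in> K" "b \<in> K" "z = a \<otimes> x \<otimes> b" using z(2) by (rule double_cosetE)
    then have "inv a \<otimes> z \<otimes> inv b = x" using assms(2) by (simp add: m_assoc inv_cancel_left)
    moreover have "inv a \<otimes> z \<otimes> inv b \<in> K" using ab(1,2) z(1) by simp
    ultimately show "x \<in> K" by simp
  qed
  then show ?thesis using assms by auto
qed

text \<open>Finiteness turns \<open>a K a\<^sup>-\<^sup>1 \<subseteq> K\<close> into an equality, which takes care of inverses of generators.\<close>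

lemma generate_normalises:
  assumes fin: "finite (carrier G)" and K: "subgroup K G" and A: "A \<subseteq> carrier G"
    and norm: "\<And>a k. a \<in> A \<Longrightarrow> k \<in> K \<Longrightarrow> a \<otimes> k \<otimes> inv a \<in> K"
    and g: "g \<in> generate G A" and k: "k \<in> K"
  shows "g \<otimes> k \<otimes> inv g \<in> K"
proof -
  interpret K: subgroup K G by fact
  show ?thesis using g k
  proof (induction arbitrary: k rule: generate.induct)
    case one
    then show ?case by simp
  next
    case (incl h)
    then show ?case using norm by simp
  next
    case (inv a)
    have a: "a \<in> carrier G" using inv A by auto
    let ?c = "\<lambda>k. a \<otimes> k \<otimes> inv a"
    have "inj_on ?c K" using a by (auto simp: inj_on_def)
    moreover have "?c ` K \<subseteq> K" using norm inv by auto
    moreover have "finite K" using fin K.subset finite_subset by blast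
    ultimately have "?c ` K = K" by (simp add: endo_inj_surj)
    then obtain k' where k': "k' \<in> K" "k = a \<otimes> k' \<otimes> inv a" using inv by auto
    then have "inv a \<otimes> k \<otimes> inv (inv a) = k'"
      using a by (simp add: m_assoc inv_cancel_left)
    then show ?case using k' by simp
  next
    case (eng g h)
    have "g \<in> carrier G" "h \<in> carrier G" using eng generate_in_carrier[OF A] by auto
    then have "g \<otimes> h \<otimes> k \<otimes> inv (g \<otimes> h) = g \<otimes> (h \<otimes> k \<otimes> inv h) \<otimes> inv g"
      using eng.prems by (simp add: m_assoc inv_mult_group)
    then show ?case using eng by simp
  qed
qed

lemma normal_if_generators_normalise:
  assumes "finite (carrier G)" "subgroup K G" "A \<subseteq> carrier G" "generate G A = carrier G"
    and "\<And>a k. a \<in> A \<Longrightarrow> k \<in> K \<Longrightarrow> a \<otimes> k \<otimes> inv a \<in> K"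
  shows "K \<lhd> G"
  using assms generate_normalises[of K A] by (intro normal_invI) auto


lemma subgroup_index_mult_card:
  assumes A: "subgroup A G" and B: "subgroup B G" and "A \<subseteq> B"
  shows "subgroup_index G B A * card A = card B"
proof -
  interpret GB: group "G\<lparr>carrier := B\<rparr>" using B by (rule subgroup_imp_group)
  have "subgroup A (G\<lparr>carrier := B\<rparr>)" using subgroup_incl[OF A B] assms(3) by blast
  from GB.lagrange[OF this] show ?thesis by (simp add: subgroup_index_def order_def)
qed

lemma card_double_coset_index:
  assumes fin: "finite (carrier G)" and K: "subgroup K G" and x: "x \<in> carrier G"
    and k: "card K = k * card (conj_inter G K x)"
  shows "card (double_coset G K x) = k * card K"
proof -
  let ?L = "conj_inter G K x"
  interpret K: subgroup K G by fact
  have "?L \<subseteq> K" by (auto simp: conj_inter_def)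
  then have "finite ?L" using fin K.subset finite_subset by metis
  moreover have "\<one> \<in> ?L"
    using subgroup_conj_inter[OF K x] by (rule subgroup.one_closed)
  ultimately have "card ?L \<noteq> 0" by auto
  moreover have "card (double_coset G K x) * card ?L = (k * card ?L) * card K"
    using card_double_coset[OF fin K x] unfolding k[symmetric] .
  then have "card (double_coset G K x) * card ?L = (k * card K) * card ?L"
    by (simp only: ac_simps)
  ultimately show ?thesis by (metis mult_cancel2)
qed

text \<open>The size of \<open>LhL\<close> is \<open>\<bar>L\<bar>\<close> times the index of \<open>L \<inter> h\<^sup>-\<^sup>1Lh\<close> in \<open>L\<close>, and this index is at least 2 unless \<open>h\<close>
  normalises \<open>L\<close>.\<close>

lemma double_coset_card_ge:
  assumes fin: "finite (carrier G)" and L: "subgroup L G" and h: "h \<in> carrier G"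
    and l: "l \<in> L" "h \<otimes> l \<otimes> inv h \<notin> L"
  shows "2 * card L \<le> card (double_coset G L h)"
proof -
  interpret L: subgroup L G by fact
  let ?C = "conj_inter G L h"
  have C: "subgroup ?C G" using L h by (rule subgroup_conj_inter)
  have CL: "?C \<subseteq> L" by (auto simp: conj_inter_def)
  have finL: "finite L" using fin L.subset finite_subset by blast
  have "l \<notin> ?C" using l L h by (simp add: mem_conj_inter_iff)
  then have "?C \<noteq> L" using l(1) by blast
  then have lt: "card ?C < card L" using CL finL by (simp add: psubset_card_mono psubset_eq)
  obtain k where k: "card L = k * card ?C"
    using subgroup_index_mult_card[OF C L CL] by metis
  have "2 \<le> k" using lt k by (cases "k \<le> 1") (auto simp: le_Suc_eq)
  have "card (double_coset G L h) = k * card L"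
    using fin L h k by (rule card_double_coset_index)
  then show ?thesis using \<open>2 \<le> k\<close> by simp
qed

lemma double_coset_outside:
  assumes H: "subgroup H G" and L: "subgroup L G" and LH: "L \<subseteq> H" and h: "h \<in> H - L"
  shows "double_coset G L h \<subseteq> H - L"
proof -
  interpret H: subgroup H G by fact
  have "h \<in> carrier G" using h by auto
  then have "L \<inter> double_coset G L h = {}"
    using subgroup_disjoint_double_coset[OF L] h by blast
  moreover have "double_coset G L h \<subseteq> H" using LH h by (auto simp: double_coset_def)
  ultimately show ?thesis by auto
qed

text \<open>Otherwise \<open>LhL\<close> would have at least \<open>2\<bar>L\<bar>\<close> elements, while only \<open>\<bar>L\<bar>\<close> elements of \<open>H\<close> are outside \<open>L\<close>.\<close>

lemma index_2_normalised:
  assumes fin: "finite (carrier G)" and H: "subgroup H G" and L: "subgroup L G" and LH: "L \<subseteq> H"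
    and card: "card H = 2 * card L" and h: "h \<in> H" and l: "l \<in> L"
  shows "h \<otimes> l \<otimes> inv h \<in> L"
proof (rule ccontr)
  interpret H: subgroup H G by fact
  interpret L: subgroup L G by fact
  assume not: "\<not> ?thesis"
  then have hL: "h \<in> H - L" using h l by auto
  have finH: "finite H" using fin H.subset finite_subset by blast
  have "2 * card L \<le> card (double_coset G L h)"
    using double_coset_card_ge[OF fin L _ l not] h by simp
  also have "\<dots> \<le> card (H - L)"
    using double_coset_outside[OF H L LH hL] finH by (simp add: card_mono)
  also have "\<dots> = card L" using LH finH card by (simp add: card_Diff_subset finite_subset)
  finally have "card L = 0" by simp
  then show False using l finH LH finite_subset by fastforce
qed

text \<open>A subgroup of index 3 is maximal. So an element \<open>h\<close> of \<open>H - L\<close> that normalised \<open>L\<close> would generate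
  with it the whole of \<open>H\<close>, and \<open>L\<close> would be normal in \<open>H\<close>. Hence \<open>LhL\<close> has at least \<open>2\<bar>L\<bar>\<close> elements,
  as many as \<open>H - L\<close>.\<close>

lemma index_3_double_coset:
  assumes fin: "finite (carrier G)" and H: "subgroup H G" and L: "subgroup L G" and LH: "L \<subseteq> H"
    and card: "card H = 3 * card L"
    and not: "h0 \<in> H" "l0 \<in> L" "h0 \<otimes> l0 \<otimes> inv h0 \<notin> L"
    and h: "h \<in> H - L"
  shows "double_coset G L h = H - L"
proof -
  interpret H: subgroup H G by fact
  interpret L: subgroup L G by fact
  have finH: "finite H" using fin H.subset finite_subset by blast
  have finL: "finite L" using finH LH finite_subset by blast
  have hc: "h \<in> carrier G" using h by auto
  have "\<exists>l\<in>L. h \<otimes> l \<otimes> inv h \<notin> L"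
  proof (rule ccontr)
    assume norm: "\<not> ?thesis"
    let ?A = "insert h L" and ?M = "generate G (insert h L)"
    have A: "?A \<subseteq> carrier G" using hc by auto
    have M: "subgroup ?M G" using A by (rule generate_is_subgroup)
    have MH: "?M \<subseteq> H" using generate_subgroup_incl[OF _ H] h LH by auto
    have LM: "L \<subseteq> ?M" and hM: "h \<in> ?M" by (auto intro: generate.incl)
    have finM: "finite ?M" using MH finH finite_subset by blast
    have less: "card L < card ?M" using LM hM h finM by (intro psubset_card_mono) auto
    obtain i where i: "i * card L = card ?M"
      using subgroup_index_mult_card[OF L M LM] by blast
    obtain j where j: "j * card ?M = 3 * card L"
      using subgroup_index_mult_card[OF M H MH] card by metis
    have pos: "0 < card L" using not(2) finL by (auto simp: card_gt_0_iff)
    have "(j * i) * card L = 3 * card L" using i j by (simp add: mult.assoc)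
    then have "j * i = 3" using pos by (metis mult_cancel2 less_numeral_extra(3))
    then have "i dvd 3" by (metis dvd_triv_right)
    then have "i \<le> 3" by (simp add: dvd_imp_le)
    then have "i = 0 \<or> i = 1 \<or> i = 2 \<or> i = 3" by linarith
    then have "i = 1 \<or> i = 3" using \<open>j * i = 3\<close> by presburger
    moreover have "i \<noteq> 1" using less i by auto
    ultimately have "card ?M = card H" using i card by simp
    then have "?M = H" using MH finH by (simp add: card_subset_eq)
    moreover have "a \<otimes> k \<otimes> inv a \<in> L" if "a \<in> ?A" "k \<in> L" for a k
      using that norm by auto
    ultimately show False using generate_normalises[OF fin L A, of h0 l0] not by auto
  qed
  then obtain l where l: "l \<in> L" "h \<otimes> l \<otimes> inv h \<notin> L" by blast
  have sub: "double_coset G L h \<subseteq> H - L" using H L LH h by (rule double_coset_outside)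
  have "card (H - L) = 2 * card L" using LH finL card by (simp add: card_Diff_subset)
  then have "card (H - L) \<le> card (double_coset G L h)"
    using double_coset_card_ge[OF fin L hc l] by simp
  then show ?thesis using sub finH by (intro card_seteq) auto
qed

section \<open>The cube of a subgroup extended by an element\<close>

text \<open>Conjugation by \<open>x\<close> sends \<open>H \<inter> x\<^sup>-\<^sup>1Hx\<close> to \<open>xHx\<^sup>-\<^sup>1 \<inter> H\<close>, and \<open>xHx\<^sup>-\<^sup>1 = x\<^sup>-\<^sup>1Hx\<close> because \<open>x\<^sup>2 \<in> H\<close>.\<close>

lemma square_normalises_conj_inter:
  assumes H: "subgroup H G" and x: "x \<in> carrier G" and xx: "x \<otimes> x \<in> H"
    and l: "l \<in> conj_inter G H x"
  shows "x \<otimes> l \<otimes> inv x \<in> conj_inter G H x" "inv x \<otimes> l \<otimes> x \<in> conj_inter G H x"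
proof -
  interpret H: subgroup H G by fact
  have lH: "l \<in> H" "x \<otimes> l \<otimes> inv x \<in> H" using l H x by (auto simp: mem_conj_inter_iff)
  have "x \<otimes> x \<otimes> l \<otimes> inv (x \<otimes> x) \<in> H" using lH xx by simp
  also have "x \<otimes> x \<otimes> l \<otimes> inv (x \<otimes> x) = x \<otimes> (x \<otimes> l \<otimes> inv x) \<otimes> inv x"
    using x lH(1) by (simp add: m_assoc inv_mult_group)
  finally show "x \<otimes> l \<otimes> inv x \<in> conj_inter G H x"
    using lH H x by (simp add: mem_conj_inter_iff)
  have "inv (x \<otimes> x) \<otimes> (x \<otimes> l \<otimes> inv x) \<otimes> (x \<otimes> x) \<in> H" using lH xx by simp
  also have "inv (x \<otimes> x) \<otimes> (x \<otimes> l \<otimes> inv x) \<otimes> (x \<otimes> x) = inv x \<otimes> l \<otimes> x"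
    using x lH(1) by (simp add: m_assoc inv_mult_group inv_cancel_left)
  finally have "inv x \<otimes> l \<otimes> x \<in> H" .
  moreover have "x \<otimes> (inv x \<otimes> l \<otimes> x) \<otimes> inv x = l"
    using x lH(1) by (simp add: m_assoc inv_cancel_left)
  ultimately show "inv x \<otimes> l \<otimes> x \<in> conj_inter G H x"
    using lH(1) H x by (simp add: mem_conj_inter_iff)
qed

text \<open>As \<open>x\<close> normalises \<open>L\<close>, the set \<open>x(LhL)x = L(xhx)L\<close> lies in \<open>HxH\<close> as soon as \<open>xhx\<close> does. Since
  \<open>LhL = H - L\<close>, this would put \<open>xHx\<close> into \<open>H \<union> HxH\<close>, which would then be closed under
  multiplication by the generators \<open>H\<close> and \<open>x\<close>, so it would be the whole group, of order
  \<open>\<bar>H\<bar> + 3\<bar>H\<bar>\<close>. In terms of graphs: the cosets of \<open>H\<close> form a connected cubic arc-transitive graph, and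
  such a graph has no triangle unless it is complete on four vertices.\<close>

lemma index_3_sandwich_notin_double_coset:
  assumes fin: "finite (carrier G)" and H: "subgroup H G" and x: "x \<in> carrier G" and xx: "x \<otimes> x \<in> H"
    and gen: "generate G (insert x H) = carrier G"
    and card: "card H = 3 * card (conj_inter G H x)"
    and not: "h0 \<in> H" "l0 \<in> conj_inter G H x" "h0 \<otimes> l0 \<otimes> inv h0 \<notin> conj_inter G H x"
    and order: "card (carrier G) \<noteq> 4 * card H"
    and h: "h \<in> H - conj_inter G H x"
  shows "x \<otimes> h \<otimes> x \<notin> double_coset G H x"
proof
  interpret H: subgroup H G by fact
  let ?L = "conj_inter G H x" and ?D = "double_coset G H x"
  have L: "subgroup ?L G" using H x by (rule subgroup_conj_inter)
  interpret L: subgroup ?L G by fact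
  have LH: "?L \<subseteq> H" by (auto simp: conj_inter_def)
  have finH: "finite H" using fin H.subset finite_subset by blast
  have finL: "finite ?L" using finH LH finite_subset by blast
  assume xhx: "x \<otimes> h \<otimes> x \<in> ?D"
  \<comment> \<open>The elements of \<open>L\<close> always give products in \<open>H\<close>; the others are moved to \<open>h\<close> by two factors from \<open>L\<close>.\<close>
  have sandwich: "x \<otimes> k \<otimes> x \<in> H \<union> ?D" if k: "k \<in> H" for k
  proof (cases "k \<in> ?L")
    case True
    then have "x \<otimes> k \<otimes> inv x \<in> H" using H x by (simp add: mem_conj_inter_iff)
    then have "x \<otimes> k \<otimes> inv x \<otimes> (x \<otimes> x) \<in> H" using xx by simp
    also have "x \<otimes> k \<otimes> inv x \<otimes> (x \<otimes> x) = x \<otimes> k \<otimes> x"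
      using x k by (simp add: m_assoc inv_cancel_left)
    finally show ?thesis by simp
  next
    case False
    then have "k \<in> double_coset G ?L h"
      using index_3_double_coset[OF fin H L LH card not h] k by simp
    then obtain a b where ab: "a \<in> ?L" "b \<in> ?L" "k = a \<otimes> h \<otimes> b" by (rule double_cosetE)
    have abH: "a \<in> H" "b \<in> H" using ab LH by auto
    have c: "x \<otimes> a \<otimes> inv x \<in> H" "inv x \<otimes> b \<otimes> x \<in> H"
      using square_normalises_conj_inter[OF H x xx] ab(1,2) LH by auto
    have "(x \<otimes> a \<otimes> inv x) \<otimes> (x \<otimes> h \<otimes> x) \<otimes> (inv x \<otimes> b \<otimes> x) \<in> ?D"
      using double_coset_mult_closed[OF H x] c xhx by simp
    also have "(x \<otimes> a \<otimes> inv x) \<otimes> (x \<otimes> h \<otimes> x) \<otimes> (inv x \<otimes> b \<otimes> x) = x \<otimes> k \<otimes> x"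
      unfolding ab(3) using x abH h by (simp add: m_assoc inv_cancel_left)
    finally show ?thesis by simp
  qed
  have Dc: "?D \<subseteq> carrier G" using H x by (rule double_coset_subset_carrier)
  have xD: "x \<in> ?D" using H x by (rule mem_double_coset_self)
  have mult_H: "m \<otimes> k \<in> H \<union> ?D" if "m \<in> H \<union> ?D" "k \<in> H" for m k
    using that double_coset_mult_closed(1)[OF H x] by auto
  have mult_x: "m \<otimes> x \<in> H \<union> ?D" if m: "m \<in> H \<union> ?D" for m
  proof (cases "m \<in> H")
    case True
    then show ?thesis using double_coset_mult_closed(2)[OF H x xD] by simp
  next
    case False
    then obtain a b where ab: "a \<in> H" "b \<in> H" "m = a \<otimes> x \<otimes> b" using m by (auto elim: double_cosetE)
    have "a \<otimes> (x \<otimes> b \<otimes> x) \<in> H \<union> ?D"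
      using sandwich[OF ab(2)] double_coset_mult_closed(2)[OF H x] ab(1) by auto
    also have "a \<otimes> (x \<otimes> b \<otimes> x) = m \<otimes> x" using ab x by (simp add: m_assoc)
    finally show ?thesis .
  qed
  have mult_inv_x: "m \<otimes> inv x \<in> H \<union> ?D" if m: "m \<in> H \<union> ?D" for m
  proof -
    have "m \<in> carrier G" using m Dc by auto
    then have "m \<otimes> inv x = (m \<otimes> x) \<otimes> inv (x \<otimes> x)"
      using x by (simp add: m_assoc inv_mult_group inv_cancel_left)
    then show ?thesis using mult_H[OF mult_x[OF m]] xx by simp
  qed
  have closed: "\<forall>m\<in>H \<union> ?D. m \<otimes> g \<in> H \<union> ?D" if "g \<in> generate G (insert x H)" for g
    using that
  proof (induction rule: generate.induct)
    case one
    then show ?case using Dc by auto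
  next
    case (incl g)
    then show ?case using mult_H mult_x by blast
  next
    case (inv g)
    then show ?case using mult_H mult_inv_x by blast
  next
    case (eng g g')
    have "g \<in> carrier G" "g' \<in> carrier G" using eng(1,2) gen by auto
    moreover have "m \<in> carrier G" if "m \<in> H \<union> ?D" for m using that Dc by auto
    ultimately show ?case using eng by (metis m_assoc)
  qed
  have "carrier G \<subseteq> H \<union> ?D"
  proof
    fix g assume g: "g \<in> carrier G"
    then have "g \<in> generate G (insert x H)" using gen by simp
    then have "\<forall>m\<in>H \<union> ?D. m \<otimes> g \<in> H \<union> ?D" by (rule closed)
    then have "\<one> \<otimes> g \<in> H \<union> ?D" using H.one_closed by blast
    then show "g \<in> H \<union> ?D" using g by simp
  qed
  then have carr: "carrier G = H \<union> ?D" using Dc by auto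
  have cD: "card ?D = 9 * card ?L" using card_double_coset_index[OF fin H x card] card by simp
  have "x \<notin> H"
  proof
    assume "x \<in> H"
    then have "?L = H" using H x by (auto simp: mem_conj_inter_iff)
    then show False using h by auto
  qed
  then have "H \<inter> ?D = {}" using subgroup_disjoint_double_coset[OF H x] by simp
  moreover have "finite ?D" using Dc fin finite_subset by blast
  ultimately have "card (carrier G) = card H + card ?D"
    unfolding carr using finH by (simp add: card_Un_disjoint)
  then show False using order cD card by simp
qed

text \<open>With \<open>l = \<bar>L\<bar>\<close> the three pieces have \<open>3l\<close>, \<open>9l\<close> and \<open>2l\<close> elements and are pairwise disjoint.\<close>

lemma card_index_3_products:
  assumes fin: "finite (carrier G)" and H: "subgroup H G" and x: "x \<in> carrier G" and xx: "x \<otimes> x \<in> H"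
    and gen: "generate G (insert x H) = carrier G"
    and card: "card H = 3 * card (conj_inter G H x)"
    and not: "h0 \<in> H" "l0 \<in> conj_inter G H x" "h0 \<otimes> l0 \<otimes> inv h0 \<notin> conj_inter G H x"
    and order: "card (carrier G) \<noteq> 4 * card H"
  shows "card (H \<union> double_coset G H x \<union> (\<lambda>h. x \<otimes> h \<otimes> x) ` (H - conj_inter G H x))
    = 14 * card (conj_inter G H x)"
proof -
  interpret H: subgroup H G by fact
  let ?L = "conj_inter G H x" and ?D = "double_coset G H x"
  let ?X = "(\<lambda>h. x \<otimes> h \<otimes> x) ` (H - ?L)"
  interpret L: subgroup ?L G using H x by (rule subgroup_conj_inter)
  have LH: "?L \<subseteq> H" by (auto simp: conj_inter_def)
  have finH: "finite H" using fin H.subset finite_subset by blast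
  have finL: "finite ?L" using finH LH finite_subset by blast
  have finD: "finite ?D" using double_coset_subset_carrier[OF H x] fin finite_subset by blast
  have cD: "card ?D = 9 * card ?L" using card_double_coset_index[OF fin H x card] card by simp
  have "inj_on (\<lambda>h. x \<otimes> h \<otimes> x) (H - ?L)" using x by (auto simp: inj_on_def)
  then have cX: "card ?X = 2 * card ?L"
    using card LH finL by (simp add: card_image card_Diff_subset)
  have "?L \<noteq> H"
    using not by auto
  then have "x \<notin> H" using H x by (auto simp: mem_conj_inter_iff)
  then have HD: "H \<inter> ?D = {}" using subgroup_disjoint_double_coset[OF H x] by simp
  have "x \<otimes> h \<otimes> x \<notin> H" if h: "h \<in> H - ?L" for h
  proof
    assume "x \<otimes> h \<otimes> x \<in> H"
    then have "x \<otimes> h \<otimes> x \<otimes> inv (x \<otimes> x) \<in> H" using xx by simp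
    also have "x \<otimes> h \<otimes> x \<otimes> inv (x \<otimes> x) = x \<otimes> h \<otimes> inv x"
      using x h by (simp add: m_assoc inv_mult_group inv_cancel_left)
    finally show False using h H x by (simp add: mem_conj_inter_iff)
  qed
  then have HX: "(H \<union> ?D) \<inter> ?X = {}"
    using index_3_sandwich_notin_double_coset[OF assms] by auto
  have "card (H \<union> ?D \<union> ?X) = card H + card ?D + card ?X"
    using HD HX finH finD by (simp add: card_Un_disjoint)
  then show ?thesis using card cD cX by simp
qed

lemma set_cube_supset:
  assumes H: "subgroup H G" and x: "x \<in> carrier G" and S: "H \<union> {x, inv x} \<subseteq> S"
  shows "H \<union> double_coset G H x \<union> double_coset G H (inv x) \<subseteq> set_cube G S"
    and "h \<in> H \<Longrightarrow> x \<otimes> h \<otimes> x \<in> set_cube G S"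
proof -
  interpret H: subgroup H G by fact
  have "h \<in> set_cube G S" if h: "h \<in> H" for h
  proof -
    have "h \<otimes> \<one> \<otimes> \<one> \<in> set_cube G S" using h S by (intro set_cubeI) auto
    then show ?thesis using h by simp
  qed
  moreover have "double_coset G H y \<subseteq> set_cube G S" if "y \<in> S" for y
    using that S by (auto elim!: double_cosetE intro!: set_cubeI)
  ultimately show "H \<union> double_coset G H x \<union> double_coset G H (inv x) \<subseteq> set_cube G S"
    using S by auto
  show "h \<in> H \<Longrightarrow> x \<otimes> h \<otimes> x \<in> set_cube G S"
    using S by (auto intro!: set_cubeI)
qed

lemma double_coset_inv:
  assumes H: "subgroup H G" and x: "x \<in> carrier G"
  shows "double_coset G H (inv x) = m_inv G ` double_coset G H x"
proof -
  interpret H: subgroup H G by fact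
  have sub: "m_inv G ` double_coset G H y \<subseteq> double_coset G H (inv y)" if "y \<in> carrier G" for y
  proof (clarify elim!: double_cosetE)
    fix a b assume "a \<in> H" "b \<in> H"
    then have "inv (a \<otimes> y \<otimes> b) = inv b \<otimes> inv y \<otimes> inv a"
      using that by (simp add: inv_mult_group m_assoc)
    then show "inv (a \<otimes> y \<otimes> b) \<in> double_coset G H (inv y)"
      using \<open>a \<in> H\<close> \<open>b \<in> H\<close> by (simp add: double_cosetI)
  qed
  have "double_coset G H (inv x) \<subseteq> m_inv G ` double_coset G H x"
  proof
    fix z assume z: "z \<in> double_coset G H (inv x)"
    then have "inv z \<in> double_coset G H x" using sub[of "inv x"] x by auto
    moreover have "z = inv (inv z)"
      using z double_coset_subset_carrier[OF H, of "inv x"] x by auto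
    ultimately show "z \<in> m_inv G ` double_coset G H x" by (rule rev_image_eqI)
  qed
  then show ?thesis using sub[OF x] by auto
qed

lemma card_double_coset_inv:
  assumes H: "subgroup H G" and x: "x \<in> carrier G"
  shows "card (double_coset G H (inv x)) = card (double_coset G H x)"
proof -
  have "inj_on (m_inv G) (double_coset G H x)"
    using double_coset_subset_carrier[OF H x] by (auto simp: inj_on_def)
  then show ?thesis using double_coset_inv[OF H x] by (simp add: card_image)
qed


lemma normal_conj_inter:
  assumes fin: "finite (carrier G)" and H: "subgroup H G" and x: "x \<in> carrier G" and xx: "x \<otimes> x \<in> H"
    and gen: "generate G (insert x H) = carrier G"
    and norm: "\<And>h l. h \<in> H \<Longrightarrow> l \<in> conj_inter G H x \<Longrightarrow> h \<otimes> l \<otimes> inv h \<in> conj_inter G H x"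
  shows "conj_inter G H x \<lhd> G"
proof (rule normal_if_generators_normalise[OF fin subgroup_conj_inter[OF H x] _ gen])
  show "insert x H \<subseteq> carrier G" using x subgroup.subset[OF H] by auto
  show "a \<otimes> k \<otimes> inv a \<in> conj_inter G H x"
    if "a \<in> insert x H" "k \<in> conj_inter G H x" for a k
    using that norm square_normalises_conj_inter(1)[OF H x xx] by auto
qed

text \<open>From \<open>x\<^sup>-\<^sup>1 = a x b\<close> one gets \<open>x a x = b\<^sup>-\<^sup>1\<close>, so \<open>(x a)\<^sup>2 = b\<^sup>-\<^sup>1 a\<close>.\<close>

lemma square_mem_in_coset:
  assumes H: "subgroup H G" and x: "x \<in> carrier G"
    and eq: "double_coset G H (inv x) = double_coset G H x"
  obtains a where "a \<in> H" "(x \<otimes> a) \<otimes> (x \<otimes> a) \<in> H"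
proof -
  interpret H: subgroup H G by fact
  have "inv x \<in> double_coset G H x" using mem_double_coset_self[OF H, of "inv x"] x eq by simp
  then obtain a b where ab: "a \<in> H" "b \<in> H" "inv x = a \<otimes> x \<otimes> b" by (rule double_cosetE)
  have "a \<otimes> x = (a \<otimes> x \<otimes> b) \<otimes> inv b" using ab(1,2) x by (simp add: m_assoc)
  also have "\<dots> = inv x \<otimes> inv b" using ab(3) by simp
  finally have ax: "a \<otimes> x = inv x \<otimes> inv b" .
  have "(x \<otimes> a) \<otimes> (x \<otimes> a) = x \<otimes> (a \<otimes> x) \<otimes> a" using ab(1) x by (simp add: m_assoc)
  also have "\<dots> = inv b \<otimes> a" unfolding ax using ab(1,2) x by (simp add: m_assoc inv_cancel_left)
  finally have "(x \<otimes> a) \<otimes> (x \<otimes> a) \<in> H" using ab by simp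
  then show thesis using that ab(1) by blast
qed

lemma generate_insert_translate:
  assumes H: "subgroup H G" and x: "x \<in> carrier G" and a: "a \<in> H"
    and gen: "generate G (insert x H) = carrier G"
  shows "generate G (insert (x \<otimes> a) H) = carrier G"
proof -
  interpret H: subgroup H G by fact
  let ?M = "generate G (insert (x \<otimes> a) H)"
  have sub: "insert (x \<otimes> a) H \<subseteq> carrier G" using x a by auto
  have "(x \<otimes> a) \<otimes> inv a \<in> ?M" using a by (intro generate.eng generate.incl) auto
  also have "(x \<otimes> a) \<otimes> inv a = x" using x a by (simp add: m_assoc)
  finally have "x \<in> ?M" .
  moreover have "H \<subseteq> ?M" by (auto intro: generate.incl)
  ultimately have "generate G (insert x H) \<subseteq> ?M"
    using generate_is_subgroup[OF sub] by (intro generate_subgroup_incl) auto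
  then show ?thesis using gen generate_incl[OF sub] by auto
qed

text \<open>The case of index at most 3 with \<open>HxH = Hx\<^sup>-\<^sup>1H\<close> is reduced to a square in \<open>H\<close> by passing from \<open>x\<close> to some
  \<open>y = x a\<close> with \<open>a \<in> H\<close>. This changes neither the double coset nor the generated group, nor the order
  of the core, and \<open>yHy = xHx a\<close> is only a translate of a part of the cube.\<close>

lemma card_set_cube_ge:
  assumes fin: "finite (carrier G)" and H: "subgroup H G" and cH: "card H = 48"
    and x: "x \<in> carrier G"
    and gen: "generate G (insert x H) = carrier G"
    and no_normal: "\<And>N. N \<lhd> G \<Longrightarrow> card N \<notin> {16, 24, 48}"
    and order: "card (carrier G) \<noteq> 192"
    and S: "H \<union> {x, inv x} \<subseteq> S" "S \<subseteq> carrier G"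
  shows "224 \<le> card (set_cube G S)"
proof -
  interpret H: subgroup H G by fact
  let ?L = "conj_inter G H x" and ?D = "double_coset G H x"
  have L: "subgroup ?L G" using H x by (rule subgroup_conj_inter)
  have LH: "?L \<subseteq> H" by (auto simp: conj_inter_def)
  have finH: "finite H" using fin H.subset finite_subset by blast
  have finC: "finite (set_cube G S)"
    by (rule finite_subset[OF _ fin]) (use S(2) in \<open>auto simp: set_cube_def subset_iff\<close>)
  have not_core: "?L \<noteq> H"
  proof
    assume "?L = H"
    have "a \<otimes> k \<otimes> inv a \<in> H" if "a \<in> insert x H" "k \<in> H" for a k
    proof (cases "a = x")
      case True
      have "k \<in> ?L" using \<open>?L = H\<close> that(2) by simp
      then show ?thesis using True mem_conj_inter_iff[OF H x] by simp
    next
      case False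
      then show ?thesis using that by simp
    qed
    then have "H \<lhd> G"
      using normal_if_generators_normalise[OF fin H _ gen] x H.subset by blast
    then show False using no_normal cH by auto
  qed
  have xH: "x \<notin> H"
  proof
    assume "x \<in> H"
    then have "?L = H" using H x by (auto simp: mem_conj_inter_iff)
    then show False using not_core by simp
  qed
  obtain k where k: "card H = k * card ?L"
    using subgroup_index_mult_card[OF L H LH] by metis
  have cD: "card ?D = k * 48" using card_double_coset_index[OF fin H x k] cH by simp
  have HD: "H \<inter> ?D = {}" using subgroup_disjoint_double_coset[OF H x xH] .
  have finD: "finite ?D" using double_coset_subset_carrier[OF H x] fin finite_subset by blast
  have "k \<noteq> 0" using k cH by (metis mult_0 zero_neq_numeral)
  moreover have "k \<noteq> 1"
  proof
    assume "k = 1"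
    then have "card ?L = card H" using k by simp
    then show False using card_subset_eq[OF finH LH] not_core by simp
  qed
  ultimately consider "4 \<le> k" | "k = 2 \<or> k = 3" by linarith
  then show ?thesis
  proof cases
    case 1
    have "card (H \<union> ?D) = 48 + k * 48" using HD finH finD cH cD by (simp add: card_Un_disjoint)
    moreover have "card (H \<union> ?D) \<le> card (set_cube G S)"
      using set_cube_supset(1)[OF H x S(1)] finC by (intro card_mono) auto
    ultimately show ?thesis using 1 by linarith
  next
    case 2
    let ?D' = "double_coset G H (inv x)"
    show ?thesis
    proof (cases "?D' = ?D")
      case False
      have "inv x \<notin> ?D" using False double_coset_eq[OF H x] by blast
      then have DD: "?D \<inter> ?D' = {}" using double_coset_disjoint[OF H x] x by simp
      have "inv x \<notin> H" using xH x H.m_inv_closed[of "inv x"] by auto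
      then have HD': "H \<inter> ?D' = {}" using subgroup_disjoint_double_coset[OF H] x by simp
      have finD': "finite ?D'" using double_coset_subset_carrier[OF H, of "inv x"] x fin finite_subset by blast
      have "card (H \<union> ?D \<union> ?D') = card (H \<union> ?D) + card ?D'"
        using DD HD' finH finD finD' by (intro card_Un_disjoint) auto
      also have "\<dots> = 48 + k * 48 + k * 48"
        using HD finH finD cH cD card_double_coset_inv[OF H x] by (simp add: card_Un_disjoint)
      finally have "card (H \<union> ?D \<union> ?D') = 48 + k * 48 + k * 48" .
      moreover have "card (H \<union> ?D \<union> ?D') \<le> card (set_cube G S)"
        using set_cube_supset(1)[OF H x S(1)] finC by (intro card_mono) auto
      ultimately show ?thesis using 2 by linarith
    next
      case True
      then obtain a where a: "a \<in> H" "(x \<otimes> a) \<otimes> (x \<otimes> a) \<in> H"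
        using square_mem_in_coset[OF H x] by blast
      define y where "y = x \<otimes> a"
      have y: "y \<in> carrier G" and yy: "y \<otimes> y \<in> H" using a x by (auto simp: y_def)
      have geny: "generate G (insert y H) = carrier G"
        unfolding y_def using H x a(1) gen by (rule generate_insert_translate)
      have "y \<in> ?D" unfolding y_def
        using double_coset_mult_closed(1)[OF H x mem_double_coset_self[OF H x] a(1)] .
      then have Dy: "double_coset G H y = ?D" by (rule double_coset_eq[OF H x])
      let ?L' = "conj_inter G H y"
      have L': "subgroup ?L' G" using H y by (rule subgroup_conj_inter)
      have LH': "?L' \<subseteq> H" by (auto simp: conj_inter_def)
      have "card ?D * card ?L' = card ?D * card ?L"
        using card_double_coset[OF fin H x] card_double_coset[OF fin H y] unfolding Dy by simp
      moreover have "card ?D \<noteq> 0" using cD \<open>k \<noteq> 0\<close> by simp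
      ultimately have cL': "card ?L' = card ?L" by (metis mult_cancel1)
      then have k': "card H = k * card ?L'" using k by simp
      have "card ?L' \<in> {16, 24, 48}" using k' cH 2 by auto
      then have "\<not> ?L' \<lhd> G" using no_normal by blast
      then obtain h0 l0 where not: "h0 \<in> H" "l0 \<in> ?L'" "h0 \<otimes> l0 \<otimes> inv h0 \<notin> ?L'"
        using normal_conj_inter[OF fin H y yy geny] by blast
      then have "k \<noteq> 2" using index_2_normalised[OF fin H L' LH'] k' by blast
      then have k3: "card H = 3 * card ?L'" using 2 k' by simp
      let ?X = "(\<lambda>h. y \<otimes> h \<otimes> y) ` (H - ?L')"
      have "card (H \<union> double_coset G H y \<union> ?X) = 14 * card ?L'"
        using card_index_3_products[OF fin H y yy geny k3 not] order cH by simp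
      also have "\<dots> = 224" using k3 cH by simp
      finally have c: "card (H \<union> ?D \<union> ?X) = 224" unfolding Dy .
      \<comment> \<open>The product \<open>y h y = x (a h) x a\<close> becomes a product of three elements of \<open>S\<close> after cancelling the
          last factor \<open>a\<close>.\<close>
      have "(\<lambda>g. g \<otimes> inv a) ` (H \<union> ?D \<union> ?X) \<subseteq> set_cube G S"
      proof (rule image_subsetI)
        fix g assume g: "g \<in> H \<union> ?D \<union> ?X"
        show "g \<otimes> inv a \<in> set_cube G S"
        proof (cases "g \<in> H \<union> ?D")
          case True
          then have "g \<otimes> inv a \<in> H \<union> ?D"
            using a(1) double_coset_mult_closed(1)[OF H x] by auto
          then show ?thesis using set_cube_supset(1)[OF H x S(1)] by blast
        next
          case False
          then obtain h where h: "h \<in> H" "g = y \<otimes> h \<otimes> y" using g by auto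
          have "g \<otimes> inv a = x \<otimes> (a \<otimes> h) \<otimes> x"
            unfolding h(2) y_def using h(1) a(1) x by (simp add: m_assoc)
          then show ?thesis using set_cube_supset(2)[OF H x S(1)] h(1) a(1) by simp
        qed
      qed
      moreover have "inj_on (\<lambda>g. g \<otimes> inv a) (H \<union> ?D \<union> ?X)"
        using a(1) y double_coset_subset_carrier[OF H x] by (auto simp: inj_on_def subset_iff)
      ultimately have "card (H \<union> ?D \<union> ?X) \<le> card (set_cube G S)"
        using finC by (metis card_image card_mono)
      then show ?thesis using c by simp
    qed
  qed
qed

lemma coset_core_eq:
  assumes H: "subgroup H G" and x: "x \<in> carrier G"
  shows "(x <# H) \<inter> (H #> x) = x <# conj_inter G H x"
proof -
  interpret H: subgroup H G by fact
  have "x \<otimes> h \<in> H #> x \<longleftrightarrow> x \<otimes> h \<otimes> inv x \<in> H" if h: "h \<in> H" for h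
  proof
    assume "x \<otimes> h \<in> H #> x"
    then obtain h' where h': "h' \<in> H" "x \<otimes> h = h' \<otimes> x" by (auto simp: r_coset_def)
    then show "x \<otimes> h \<otimes> inv x \<in> H" using x by (simp add: m_assoc)
  next
    assume "x \<otimes> h \<otimes> inv x \<in> H"
    moreover have "x \<otimes> h = (x \<otimes> h \<otimes> inv x) \<otimes> x" using x h by (simp add: m_assoc)
    ultimately show "x \<otimes> h \<in> H #> x" unfolding r_coset_def by blast
  qed
  then show ?thesis
    using H x by (auto simp: l_coset_def mem_conj_inter_iff)
qed

lemma card_conj_inter_plus_core:
  assumes fin: "finite (carrier G)" and H: "subgroup H G" and x: "x \<in> carrier G" and xH: "x \<notin> H"
  shows "card (H \<union> (x <# conj_inter G H x)) = card H + card (conj_inter G H x)"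
proof -
  interpret H: subgroup H G by fact
  let ?L = "conj_inter G H x"
  have LH: "?L \<subseteq> H" by (auto simp: conj_inter_def)
  have finH: "finite H" using fin H.subset finite_subset by blast
  have finL: "finite ?L" using finH LH finite_subset by blast
  have img: "x <# ?L = (\<lambda>l. x \<otimes> l) ` ?L" by (auto simp: l_coset_def)
  have "inj_on (\<lambda>l. x \<otimes> l) ?L" using x LH H.subset by (auto simp: inj_on_def subset_iff)
  then have "card (x <# ?L) = card ?L" unfolding img by (rule card_image)
  moreover have "H \<inter> (x <# ?L) = {}"
  proof -
    have "x \<otimes> l \<notin> H" if l: "l \<in> ?L" for l
    proof
      assume "x \<otimes> l \<in> H"
      moreover have lH: "l \<in> H" using l LH by blast
      ultimately have "x \<otimes> l \<otimes> inv l \<in> H" by simp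
      moreover have "x \<otimes> l \<otimes> inv l = x" using x lH by (simp add: m_assoc)
      ultimately show False using xH by simp
    qed
    then show ?thesis unfolding img by auto
  qed
  ultimately show ?thesis using finH finL unfolding img by (simp add: card_Un_disjoint)
qed

text \<open>Adjacent factors from \<open>xL\<close> multiply into \<open>xLxL = x\<^sup>2L \<subseteq> H\<close>. So a product outside \<open>H \<union> HxH\<close> can only have
  the form \<open>(x l) h (x l')\<close>, and \<open>x l' = l'' x\<close> with \<open>l'' \<in> L\<close> turns it into \<open>x (l h l'') x\<close>.\<close>

lemma set_cube_subset:
  assumes H: "subgroup H G" and x: "x \<in> carrier G" and xx: "x \<otimes> x \<in> H"
  shows "set_cube G (H \<union> (x <# conj_inter G H x))
    \<subseteq> H \<union> double_coset G H x \<union> (\<lambda>h. x \<otimes> h \<otimes> x) ` (H - conj_inter G H x)"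
    (is "_ \<subseteq> ?R")
proof
  interpret H: subgroup H G by fact
  let ?L = "conj_inter G H x" and ?D = "double_coset G H x"
  interpret L: subgroup ?L G using H x by (rule subgroup_conj_inter)
  have LH: "l \<in> H" if "l \<in> ?L" for l using that by (auto simp: conj_inter_def)
  have core: "x \<otimes> l \<in> ?D" if "l \<in> ?L" for l
    using double_coset_mult_closed(1)[OF H x mem_double_coset_self[OF H x]] LH[OF that] by simp
  have xlx: "x \<otimes> l \<otimes> x \<in> H" if l: "l \<in> ?L" for l
  proof -
    have "(x \<otimes> l \<otimes> inv x) \<otimes> (x \<otimes> x) \<in> H"
      using l xx mem_conj_inter_iff[OF H x] by simp
    also have "(x \<otimes> l \<otimes> inv x) \<otimes> (x \<otimes> x) = x \<otimes> l \<otimes> x"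
      using x LH[OF l] by (simp add: m_assoc inv_cancel_left)
    finally show ?thesis .
  qed
  fix s assume "s \<in> set_cube G (H \<union> (x <# ?L))"
  then obtain a b c where abc: "s = a \<otimes> b \<otimes> c" and
    a: "a \<in> H \<or> (\<exists>l\<in>?L. a = x \<otimes> l)" and b: "b \<in> H \<or> (\<exists>l\<in>?L. b = x \<otimes> l)"
    and c: "c \<in> H \<or> (\<exists>l\<in>?L. c = x \<otimes> l)"
    unfolding set_cube_def l_coset_def by blast
  have prod: "x \<otimes> l \<otimes> (x \<otimes> l') \<in> H" if "l \<in> ?L" "l' \<in> ?L" for l l'
  proof -
    have "x \<otimes> l \<otimes> x \<otimes> l' \<in> H" using xlx[OF that(1)] LH[OF that(2)] by simp
    also have "x \<otimes> l \<otimes> x \<otimes> l' = x \<otimes> l \<otimes> (x \<otimes> l')"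
      using x LH[OF that(1)] LH[OF that(2)] by (simp add: m_assoc)
    finally show ?thesis .
  qed
  note D_closed = double_coset_mult_closed[OF H x]
  have carr: "u \<in> carrier G" if "u \<in> H \<or> (\<exists>l\<in>?L. u = x \<otimes> l)" for u
    using that x LH by auto
  show "s \<in> ?R"
  proof (cases "a \<in> H")
    case aH: True
    show ?thesis
    proof (cases "b \<in> H")
      case True
      then have "a \<otimes> b \<in> H" using aH by simp
      then have "s \<in> H \<union> ?D" using c abc core D_closed(2) by auto
      then show ?thesis by simp
    next
      case False
      then obtain l where l: "l \<in> ?L" "b = x \<otimes> l" using b by auto
      have "s = a \<otimes> (b \<otimes> c)" unfolding abc using carr a b c by (simp add: m_assoc)
      moreover have "b \<otimes> c \<in> H \<union> ?D"
        using c l core[OF l(1)] D_closed(1) prod by auto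
      ultimately have "s \<in> H \<union> ?D" using aH D_closed(2) by auto
      then show ?thesis by simp
    qed
  next
    case False
    then obtain l where l: "l \<in> ?L" "a = x \<otimes> l" using a by auto
    show ?thesis
    proof (cases "b \<in> H")
      case bH: True
      have ab: "a \<otimes> b \<in> ?D" using bH l core D_closed(1) by simp
      show ?thesis
      proof (cases "c \<in> H")
        case True
        then show ?thesis using ab abc D_closed(1) by simp
      next
        case False
        then obtain l' where l': "l' \<in> ?L" "c = x \<otimes> l'" using c by auto
        let ?m = "x \<otimes> l' \<otimes> inv x"
        have m: "?m \<in> ?L" using square_normalises_conj_inter(1)[OF H x xx l'(1)] .
        have s: "s = x \<otimes> (l \<otimes> b \<otimes> ?m) \<otimes> x"
          unfolding abc l(2) l'(2) using x bH LH[OF l(1)] LH[OF l'(1)] by (simp add: m_assoc)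
        have lbm: "l \<otimes> b \<otimes> ?m \<in> H" using LH[OF l(1)] bH LH[OF m] by simp
        show ?thesis
        proof (cases "l \<otimes> b \<otimes> ?m \<in> ?L")
          case True
          then show ?thesis using xlx[OF True] s by simp
        next
          case False
          then have "s \<in> (\<lambda>h. x \<otimes> h \<otimes> x) ` (H - ?L)" using lbm s by blast
          then show ?thesis by simp
        qed
      qed
    next
      case False
      then obtain l' where l': "l' \<in> ?L" "b = x \<otimes> l'" using b by auto
      have "a \<otimes> b \<in> H" using prod l l' by simp
      then have "s \<in> H \<union> ?D" using c abc core D_closed(2) by auto
      then show ?thesis by simp
    qed
  qed
qed

lemma card_set_cube_le:
  assumes fin: "finite (carrier G)" and H: "subgroup H G" and x: "x \<in> carrier G" and xx: "x \<otimes> x \<in> H"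
    and card: "card H = 3 * card (conj_inter G H x)"
  shows "card (set_cube G (H \<union> (x <# conj_inter G H x))) \<le> 14 * card (conj_inter G H x)"
proof -
  interpret H: subgroup H G by fact
  let ?L = "conj_inter G H x" and ?D = "double_coset G H x"
  let ?X = "(\<lambda>h. x \<otimes> h \<otimes> x) ` (H - ?L)"
  have LH: "?L \<subseteq> H" by (auto simp: conj_inter_def)
  have finH: "finite H" using fin H.subset finite_subset by blast
  have finL: "finite ?L" using finH LH finite_subset by blast
  have finD: "finite ?D" using double_coset_subset_carrier[OF H x] fin finite_subset by blast
  have "card (set_cube G (H \<union> (x <# ?L))) \<le> card (H \<union> ?D \<union> ?X)"
    using set_cube_subset[OF H x xx] finH finD by (intro card_mono) auto
  also have "\<dots> \<le> card H + card ?D + card ?X"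
    by (metis (no_types, lifting) add_mono card_Un_le le_refl le_trans)
  also have "card ?X \<le> card (H - ?L)" using finH by (intro card_image_le) simp
  also have "card (H - ?L) = 2 * card ?L" using LH finL card by (simp add: card_Diff_subset)
  also have "card ?D = 3 * card H" using fin H x card by (rule card_double_coset_index)
  finally show ?thesis using card by simp
qed

end

section \<open>Matrices in SL(2,p)\<close>

definition mat2 :: "'a \<Rightarrow> 'a \<Rightarrow> 'a \<Rightarrow> 'a \<Rightarrow> 'a ^ 2 ^ 2" where
  "mat2 a b c d = (\<chi> i j. if i = 1 then (if j = 1 then a else b) else (if j = 1 then c else d))"

lemma mat2_nth [simp]:
  "mat2 a b c d $ 1 $ 1 = a" "mat2 a b c d $ 1 $ 2 = b"
  "mat2 a b c d $ 2 $ 1 = c" "mat2 a b c d $ 2 $ 2 = d"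
  by (simp_all add: mat2_def)

lemma mat2_eq_iff: "A = mat2 a b c d \<longleftrightarrow> A$1$1 = a \<and> A$1$2 = b \<and> A$2$1 = c \<and> A$2$2 = d"
  by (auto simp: vec_eq_iff forall_2)

lemma mat2_eta: "mat2 (A$1$1) (A$1$2) (A$2$1) (A$2$2) = A"
  by (simp add: vec_eq_iff forall_2)

lemma mat2_mult:
  fixes a :: "'a :: comm_ring_1"
  shows "mat2 a b c d ** mat2 a' b' c' d' =
    mat2 (a * a' + b * c') (a * b' + b * d') (c * a' + d * c') (c * b' + d * d')"
  by (simp add: mat2_eq_iff matrix_matrix_mult_def sum_2)

lemma mat2_one: "mat 1 = mat2 (1 :: 'a :: comm_ring_1) 0 0 1"
  by (simp add: mat2_eq_iff mat_def)

lemma carrier_SL2_iff: "mat2 a b c d \<in> carrier SL2 \<longleftrightarrow> a * d - b * c = 1"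
  by (simp add: SL2_def det_2)

lemma SL2_mult: "A \<otimes>\<^bsub>SL2\<^esub> B = A ** B" and SL2_one: "\<one>\<^bsub>SL2\<^esub> = mat 1"
  by (simp_all add: SL2_def)

lemma SL2_inv:
  assumes "a * d - b * c = (1 :: 'p :: prime_card mod_ring)"
  shows "inv\<^bsub>SL2\<^esub> (mat2 a b c d) = mat2 d (- b) (- c) a"
proof (rule group.inv_equality[OF group_SL2])
  have "d * a - b * c = 1" "d * a - c * b = 1" using assms by (simp_all add: mult.commute)
  then show "mat2 d (- b) (- c) a \<otimes>\<^bsub>SL2\<^esub> mat2 a b c d = \<one>\<^bsub>SL2\<^esub>"
    by (simp add: SL2_mult SL2_one mat2_mult mat2_one algebra_simps)
  show "mat2 a b c d \<in> carrier SL2" "mat2 d (- b) (- c) a \<in> carrier SL2"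
    using assms by (simp_all add: carrier_SL2_iff mult.commute)
qed

lemma SL2_cases:
  assumes "A \<in> carrier (SL2 :: ('p :: prime_card mod_ring ^ 2 ^ 2) monoid)"
  obtains a b c d where "A = mat2 a b c d" "a * d - b * c = 1"
  using assms carrier_SL2_iff mat2_eta by metis

text \<open>If \<open>a \<noteq> 0\<close>, the determinant condition determines \<open>d\<close> from the free entries \<open>a\<close>, \<open>b\<close>, \<open>c\<close>; if
  \<open>a = 0\<close>, it says \<open>c = -1/b\<close> and leaves \<open>d\<close> free. The two cases contribute \<open>(p - 1)p\<^sup>2\<close> and
  \<open>(p - 1)p\<close> matrices.\<close>

lemma card_SL2:
  "card (carrier (SL2 :: ('p :: prime_card mod_ring ^ 2 ^ 2) monoid)) =
    CARD('p) * (CARD('p) - 1) * (CARD('p) + 1)"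
proof -
  let ?F = "UNIV :: 'p mod_ring set" and ?p = "CARD('p)"
  let ?A = "(\<lambda>(a, b, c). mat2 a b c ((1 + b * c) / a)) ` ((?F - {0}) \<times> ?F \<times> ?F)"
  let ?B = "(\<lambda>(b, d). mat2 0 b (- (1 / b)) d) ` ((?F - {0}) \<times> ?F)"
  have "carrier SL2 \<subseteq> ?A \<union> ?B"
  proof
    fix A :: "'p mod_ring ^ 2 ^ 2" assume "A \<in> carrier SL2"
    then obtain a b c d where A: "A = mat2 a b c d" "a * d - b * c = 1" by (rule SL2_cases)
    show "A \<in> ?A \<union> ?B"
    proof (cases "a = 0")
      case True
      then have bc: "b * c = - 1" using A(2) by (simp add: minus_equation_iff)
      then have "b \<noteq> 0" by auto
      then have "c = (b * c) / b" by simp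
      then have "c = - (1 / b)" unfolding bc by simp
      then show ?thesis using A(1) True \<open>b \<noteq> 0\<close> by (auto intro!: image_eqI[of _ _ "(b, d)"])
    next
      case False
      then have "d = (1 + b * c) / a" using A(2) by (simp add: field_simps)
      then show ?thesis using A(1) False by (auto intro!: image_eqI[of _ _ "(a, b, c)"])
    qed
  qed
  moreover have "?A \<union> ?B \<subseteq> carrier SL2" by (auto simp: carrier_SL2_iff split: if_splits)
  ultimately have "carrier SL2 = ?A \<union> ?B" by blast
  moreover have "?A \<inter> ?B = {}" by (auto simp: mat2_eq_iff)
  ultimately have "card (carrier (SL2 :: ('p mod_ring ^ 2 ^ 2) monoid)) = card ?A + card ?B"
    by (simp add: card_Un_disjoint)
  moreover have "card ?A = (?p - 1) * (?p * ?p)"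
    by (subst card_image) (auto simp: inj_on_def mat2_eq_iff card_cartesian_product card_Diff_subset)
  moreover have "card ?B = (?p - 1) * ?p"
    by (subst card_image) (auto simp: inj_on_def mat2_eq_iff card_cartesian_product card_Diff_subset)
  ultimately show ?thesis by (simp add: algebra_simps)
qed

lemma mat2_unipotent_pow:
  "mat2 1 t 0 1 [^]\<^bsub>SL2\<^esub> (n :: nat) = mat2 1 (of_nat n * t) 0 (1 :: 'p :: prime_card mod_ring)"
proof (induction n)
  case 0
  interpret group "SL2 :: ('p mod_ring ^ 2 ^ 2) monoid" by (rule group_SL2)
  show ?case by (simp add: SL2_one mat2_one)
next
  case (Suc n)
  interpret group "SL2 :: ('p mod_ring ^ 2 ^ 2) monoid" by (rule group_SL2)
  show ?case using Suc by (simp add: SL2_mult mat2_mult algebra_simps)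
qed

lemma ord_mat2_unipotent:
  assumes "t \<noteq> (0 :: 'p :: prime_card mod_ring)"
  shows "group.ord SL2 (mat2 1 t 0 1) = CARD('p)"
proof -
  interpret group "SL2 :: ('p mod_ring ^ 2 ^ 2) monoid" by (rule group_SL2)
  have u: "mat2 1 t 0 1 \<in> carrier SL2" by (simp add: carrier_SL2_iff)
  have "mat2 1 t 0 1 [^]\<^bsub>SL2\<^esub> n = \<one>\<^bsub>SL2\<^esub> \<longleftrightarrow> CARD('p) dvd n" for n :: nat
    using assms by (auto simp: mat2_unipotent_pow SL2_one mat2_one mat2_eq_iff of_nat_eq_0_iff_char_dvd)
  then show ?thesis using ord_unique[OF u] by blast
qed

text \<open>A noncentral matrix \<open>A\<close> of \<open>N\<close> has, after conjugation, a nonzero lower left entry, so the first basis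
  vector \<open>e\<close> is not an eigenvector of it. Its commutator with the matrix \<open>g\<close> of determinant 1 that has
  eigenvectors \<open>e\<close> and \<open>Ae\<close> with eigenvalues \<open>1/2\<close> and \<open>2\<close> is upper triangular with
  diagonal \<open>(4, 1/4)\<close>. The commutator of such a matrix with a transvection is the transvection with
  upper right entry \<open>1 - 16 = -15\<close>, which is nonzero since \<open>p\<close> exceeds 5, and so it has order \<open>p\<close>.\<close>

lemma card_prime_dvd_normal_subgroup:
  fixes N :: "('p :: prime_card mod_ring ^ 2 ^ 2) set"
  assumes N: "N \<lhd> SL2" and p: "7 \<le> CARD('p)" and big: "2 < card N"
  shows "CARD('p) dvd card N"
proof -
  interpret group "SL2 :: ('p mod_ring ^ 2 ^ 2) monoid" by (rule group_SL2)
  interpret N: normal N SL2 by fact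
  have prime: "Factorial_Ring.prime CARD('p)" by (rule prime_card)
  have nz: "of_nat n \<noteq> (0 :: 'p mod_ring)" if "Factorial_Ring.prime n" "n < 7" for n
    using that p prime by (auto simp: of_nat_eq_0_iff_char_dvd dest: primes_dvd_imp_eq)
  have two: "(2 :: 'p mod_ring) \<noteq> 0" and three: "(3 :: 'p mod_ring) \<noteq> 0" and five: "(5 :: 'p mod_ring) \<noteq> 0"
    using nz[of 2] nz[of 3] nz[of 5] by simp_all
  have "card (SL2_scalars :: ('p mod_ring ^ 2 ^ 2) set) \<le> 2"
    by (simp add: SL2_scalars_def card_insert_le_m1)
  then have "\<not> N \<subseteq> SL2_scalars" using big card_mono[of SL2_scalars N] by fastforce
  then obtain A where A: "A \<in> N" "A \<notin> SL2_scalars" by blast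
  obtain a b c d where abcd: "A = mat2 a b c d" "a * d - b * c = 1"
    using A(1) N.subset by (blast elim: SL2_cases)
  have "\<exists>a b c d. mat2 a b c d \<in> N \<and> a * d - b * c = 1 \<and> c \<noteq> 0"
  proof (cases "c = 0")
    case False
    then show ?thesis using A(1) abcd by blast
  next
    case c: True
    show ?thesis
    proof (cases "b = 0")
      case False
      have w: "mat2 0 (- 1) 1 0 \<in> carrier SL2" by (simp add: carrier_SL2_iff)
      have "mat2 0 (- 1) 1 0 \<otimes>\<^bsub>SL2\<^esub> A \<otimes>\<^bsub>SL2\<^esub> inv\<^bsub>SL2\<^esub> (mat2 0 (- 1) 1 0) \<in> N"
        using N.inv_op_closed2[OF w A(1)] .
      also have "mat2 0 (- 1) 1 0 \<otimes>\<^bsub>SL2\<^esub> A \<otimes>\<^bsub>SL2\<^esub> inv\<^bsub>SL2\<^esub> (mat2 0 (- 1) 1 0) = mat2 d 0 (- b) a"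
        unfolding abcd(1) by (simp add: SL2_inv SL2_mult mat2_mult c)
      finally show ?thesis using False abcd(2) c
        by (intro exI[of _ d] exI[of _ 0] exI[of _ "- b"] exI[of _ a]) (simp add: mult.commute)
    next
      case True
      have w: "mat2 1 0 1 1 \<in> carrier SL2" by (simp add: carrier_SL2_iff)
      have "mat2 1 0 1 1 \<otimes>\<^bsub>SL2\<^esub> A \<otimes>\<^bsub>SL2\<^esub> inv\<^bsub>SL2\<^esub> (mat2 1 0 1 1) \<in> N"
        using N.inv_op_closed2[OF w A(1)] .
      also have "mat2 1 0 1 1 \<otimes>\<^bsub>SL2\<^esub> A \<otimes>\<^bsub>SL2\<^esub> inv\<^bsub>SL2\<^esub> (mat2 1 0 1 1) = mat2 a 0 (a - d) d"
        unfolding abcd(1) by (simp add: SL2_inv SL2_mult mat2_mult c True)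
      finally have mem: "mat2 a 0 (a - d) d \<in> N" .
      have "a \<noteq> d"
      proof
        assume "a = d"
        then have "a * a = 1" using abcd(2) c by simp
        then have "(a - 1) * (a + 1) = 0" by (simp add: algebra_simps)
        then have "a = 1 \<or> a = - 1" by (auto simp: eq_neg_iff_add_eq_0)
        moreover have "- mat 1 = mat2 (- 1 :: 'p mod_ring) 0 0 (- 1)"
          by (simp add: mat2_eq_iff mat_def)
        ultimately have "A \<in> SL2_scalars"
          using \<open>a = d\<close> c True abcd(1) by (auto simp: SL2_scalars_def mat2_one)
        then show False using A(2) by simp
      qed
      then show ?thesis using mem abcd(2) c by fastforce
    qed
  qed
  then obtain a b c d where M: "mat2 a b c d \<in> N" and det: "a * d - b * c = 1" and c: "c \<noteq> 0" by blast
  \<comment> \<open>The value \<open>s\<close> is chosen such that \<open>mat2 q s 0 2\<close> maps the first column \<open>(a, c)\<close> of the matrix to its double.\<close>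
  define q where "q = 1 / (2 :: 'p mod_ring)"
  define s where "s = a * (2 - q) / c"
  have q: "q * 2 = 1" using two by (simp add: q_def)
  have s: "s * c = a * (2 - q)" using c by (simp add: s_def)
  let ?M = "mat2 a b c d" and ?g = "mat2 q s 0 2"
  have g: "?g \<in> carrier SL2" using q by (simp add: carrier_SL2_iff)
  let ?e = "q * (q * b + s * d) - 2 * a * s"
  have conj: "?g \<otimes>\<^bsub>SL2\<^esub> ?M \<otimes>\<^bsub>SL2\<^esub> inv\<^bsub>SL2\<^esub> ?g = mat2 (4 * a) ?e (4 * c) (2 * q * d - 2 * c * s)"
  proof -
    have "q * a + s * c = 2 * a" using s by (simp add: algebra_simps)
    then show ?thesis using q
      by (simp add: SL2_inv SL2_mult mat2_mult) (simp add: algebra_simps)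
  qed
  have "inv\<^bsub>SL2\<^esub> ?M \<otimes>\<^bsub>SL2\<^esub> (?g \<otimes>\<^bsub>SL2\<^esub> ?M \<otimes>\<^bsub>SL2\<^esub> inv\<^bsub>SL2\<^esub> ?g) \<in> N"
    using N.inv_op_closed2[OF g M] M by simp
  then have mem: "mat2 d (- b) (- c) a \<otimes>\<^bsub>SL2\<^esub> mat2 (4 * a) ?e (4 * c) (2 * q * d - 2 * c * s) \<in> N"
    unfolding conj SL2_inv[OF det] .
  have "d * (4 * a) + - b * (4 * c) = 4 * (a * d - b * c)" by (simp add: algebra_simps)
  then have "d * (4 * a) + - b * (4 * c) = 4" using det by simp
  moreover have "- c * (4 * a) + a * (4 * c) = 0" by (simp add: algebra_simps)
  ultimately obtain t r where tr: "mat2 4 t 0 r \<in> N"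
    using mem unfolding SL2_mult mat2_mult by metis
  have "mat2 4 t 0 r \<in> carrier SL2" using tr N.subset by blast
  then have r: "4 * r = 1" by (simp add: carrier_SL2_iff)
  let ?u = "mat2 1 1 0 1" and ?B = "mat2 4 t 0 r"
  have u: "?u \<in> carrier SL2" by (simp add: carrier_SL2_iff)
  have "?u \<otimes>\<^bsub>SL2\<^esub> ?B \<otimes>\<^bsub>SL2\<^esub> inv\<^bsub>SL2\<^esub> ?u \<otimes>\<^bsub>SL2\<^esub> inv\<^bsub>SL2\<^esub> ?B \<in> N"
    using N.inv_op_closed2[OF u tr] tr by simp
  also have "?u \<otimes>\<^bsub>SL2\<^esub> ?B \<otimes>\<^bsub>SL2\<^esub> inv\<^bsub>SL2\<^esub> ?u \<otimes>\<^bsub>SL2\<^esub> inv\<^bsub>SL2\<^esub> ?B = mat2 1 (- 15) 0 1"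
  proof -
    have "r * 4 = 1" "4 * (r * x) = x" "r * (4 * x) = x" for x
      using r by (simp_all add: mult.commute flip: mult.assoc)
    then show ?thesis using r
      by (simp add: SL2_inv SL2_mult mat2_mult algebra_simps)
  qed
  finally have U: "mat2 1 (- 15) 0 1 \<in> N" .
  have "(15 :: 'p mod_ring) = 3 * 5" by simp
  then have "(- 15 :: 'p mod_ring) \<noteq> 0" using three five by (metis mult_eq_0_iff neg_equal_0_iff_equal)
  then have ord: "ord (mat2 1 (- 15) 0 1) = CARD('p)" by (rule ord_mat2_unipotent)
  let ?U = "generate SL2 {mat2 1 (- 15) 0 1 :: 'p mod_ring ^ 2 ^ 2}"
  have carr: "mat2 1 (- 15) 0 1 \<in> carrier (SL2 :: ('p mod_ring ^ 2 ^ 2) monoid)"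
    using U N.subset by blast
  have "subgroup ?U SL2" using carr by (intro generate_is_subgroup) simp
  moreover have "?U \<subseteq> N"
    using U by (intro generate_subgroup_incl N.subgroup_axioms) simp
  moreover have "card ?U = CARD('p)" using generate_pow_card[OF carr] ord by simp
  ultimately show ?thesis
    using subgroup_index_mult_card[OF _ N.subgroup_axioms] by (metis dvd_triv_right)
qed

text \<open>A copy of \<open>S\<^sub>4\<close> in the projective group consists of 24 cosets of the scalars, and its preimage is the
  union of these cosets.\<close>

lemma card_iso_2S4:
  fixes H :: "('p :: prime_card mod_ring ^ 2 ^ 2) set"
  assumes "iso_2S4 H"
  shows "card H = card (SL2_scalars :: ('p mod_ring ^ 2 ^ 2) set) * 24"
proof -
  interpret group "SL2 :: ('p mod_ring ^ 2 ^ 2) monoid" by (rule group_SL2)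
  let ?Z = "SL2_scalars :: ('p mod_ring ^ 2 ^ 2) set"
  interpret Z: normal ?Z SL2 by (rule normal_SL2_scalars)
  obtain T :: "('p mod_ring ^ 2 ^ 2) set set" where T: "subgroup T PSL2"
    and isoT: "PSL2\<lparr>carrier := T\<rparr> \<cong> sym_group 4"
    and isoH: "SL2\<lparr>carrier := H\<rparr> \<cong> SL2\<lparr>carrier := PSL2_preimage T\<rparr>"
    using assms unfolding iso_2S4_def by blast
  have "card T = card (carrier (sym_group 4))"
    using isoT by (auto simp: is_iso_def iso_def intro: bij_betw_same_card)
  also have "\<dots> = 24"
    by (simp add: sym_group_def card_permutations fact_numeral)
  finally have cT: "card T = 24" .
  have TR: "T \<subseteq> rcosets\<^bsub>SL2\<^esub> ?Z"
    using subgroup.subset[OF T] by (simp add: PSL2_def FactGroup_def)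
  have "PSL2_preimage T = \<Union>T"
  proof (intro equalityI subsetI)
    fix g assume "g \<in> PSL2_preimage T"
    then have "g \<in> carrier SL2" "?Z #>\<^bsub>SL2\<^esub> g \<in> T" by (auto simp: PSL2_preimage_def)
    then show "g \<in> \<Union>T" using rcos_self[OF _ Z.subgroup_axioms] by blast
  next
    fix g assume "g \<in> \<Union>T"
    then obtain C where C: "C \<in> T" "g \<in> C" by blast
    then obtain y where y: "y \<in> carrier SL2" "C = ?Z #>\<^bsub>SL2\<^esub> y" using TR by (auto simp: RCOSETS_def)
    have "g \<in> carrier SL2" using r_coset_subset_G[OF Z.subset y(1)] C(2) y(2) by blast
    moreover have "?Z #>\<^bsub>SL2\<^esub> g = C"
      using repr_independence[of g ?Z y] C(2) y Z.subgroup_axioms by simp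
    ultimately show "g \<in> PSL2_preimage T" using C(1) by (simp add: PSL2_preimage_def)
  qed
  moreover have "card ?Z * card T = card (\<Union>T)"
  proof (rule card_partition)
    show "finite T" using cT by (simp add: card_ge_0_finite)
    show "card C = card ?Z" if "C \<in> T" for C
      using card_rcosets_equal[of C ?Z] that TR Z.subset by auto
    show "C \<inter> C' = {}" if "C \<in> T" "C' \<in> T" "C \<noteq> C'" for C C'
      using rcos_disjoint[OF Z.subgroup_axioms] that TR by (auto simp: pairwise_def disjnt_def)
  qed simp
  moreover have "card H = card (PSL2_preimage T)"
    using isoH by (auto simp: is_iso_def iso_def intro: bij_betw_same_card)
  ultimately show ?thesis using cT by simp
qed

text \<open>Lagrange's theorem rules out \<open>p = 2\<close>, where \<open>SL(2,2)\<close> has 6 elements, then \<open>p = 3\<close> and \<open>p = 5\<close>,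
  where 48 does not divide 24 or 120. Excluding \<open>p = 2\<close> comes before computing \<open>\<bar>H\<bar>\<close>, because the
  two scalar matrices coincide for that prime.\<close>

lemma card_2S4_in_SL2:
  fixes H :: "('p :: prime_card mod_ring ^ 2 ^ 2) set"
  assumes H: "subgroup H SL2" and iso: "iso_2S4 H"
  shows "7 \<le> CARD('p)" and "card H = 48"
proof -
  interpret group "SL2 :: ('p mod_ring ^ 2 ^ 2) monoid" by (rule group_SL2)
  let ?p = "CARD('p)" and ?Z = "SL2_scalars :: ('p mod_ring ^ 2 ^ 2) set"
  have prime: "Factorial_Ring.prime ?p" by (rule prime_card)
  have "card H dvd card (carrier (SL2 :: ('p mod_ring ^ 2 ^ 2) monoid))"
    using lagrange[OF H] by (metis dvd_triv_right order_def)
  then have dvd: "card ?Z * 24 dvd ?p * (?p - 1) * (?p + 1)"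
    unfolding card_SL2 card_iso_2S4[OF iso] .
  have "?p \<noteq> 2"
  proof
    assume "?p = 2"
    then have "card ?Z * 24 dvd 6" using dvd by simp
    then have "24 dvd (6 :: nat)" by (rule dvd_mult_right)
    then show False by simp
  qed
  have "(1 :: 'p mod_ring) \<noteq> - 1"
  proof
    assume "(1 :: 'p mod_ring) = - 1"
    then have "of_nat 2 = (0 :: 'p mod_ring)" by (simp add: eq_neg_iff_add_eq_0)
    then have "?p dvd 2" by (rule of_nat_0_mod_ring_dvd)
    then show False using \<open>?p \<noteq> 2\<close> prime by (metis primes_dvd_imp_eq two_is_prime_nat)
  qed
  then have "mat 1 \<noteq> - (mat 1 :: 'p mod_ring ^ 2 ^ 2)"
    by (auto simp: vec_eq_iff mat_def)
  then have cZ: "card ?Z = 2" by (simp add: SL2_scalars_def)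
  then show "card H = 48" using card_iso_2S4[OF iso] by simp
  show "7 \<le> ?p"
  proof (rule ccontr)
    assume "\<not> ?thesis"
    then have "?p = 0 \<or> ?p = 1 \<or> ?p = 2 \<or> ?p = 3 \<or> ?p = 4 \<or> ?p = 5 \<or> ?p = 6" by linarith
    moreover have "?p \<noteq> 0" "?p \<noteq> 1" "?p \<noteq> 4" "?p \<noteq> 6"
    proof -
      have "\<not> Factorial_Ring.prime (4 :: nat)" "\<not> Factorial_Ring.prime (6 :: nat)" by simp_all
      then show "?p \<noteq> 0" "?p \<noteq> 1" "?p \<noteq> 4" "?p \<noteq> 6" using prime by (metis not_prime_0, metis not_prime_1, metis, metis)
    qed
    ultimately consider "?p = 3" | "?p = 5" using \<open>?p \<noteq> 2\<close> by blast
    then show False using dvd cZ by cases simp_all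
  qed
qed

section \<open>Growth of the cube\<close>

lemma SL2_no_small_normal_subgroup:
  fixes N :: "('p :: prime_card mod_ring ^ 2 ^ 2) set"
  assumes N: "N \<lhd> SL2" and p: "7 \<le> CARD('p)"
  shows "card N \<notin> {16, 24, 48}"
proof
  assume N_card: "card N \<in> {16, 24, 48}"
  then have "2 < card N" by auto
  then have "CARD('p) dvd card N" by (rule card_prime_dvd_normal_subgroup[OF N p])
  also have "card N dvd 2 ^ 4 * 3" using N_card by auto
  finally have "CARD('p) dvd 2 ^ 4 \<or> CARD('p) dvd 3"
    using prime_dvd_mult_iff[OF prime_card] by blast
  then have "CARD('p) dvd 2 \<or> CARD('p) dvd 3"
    using prime_dvd_power[OF prime_card] by blast
  then show False using p by (auto dest: dvd_imp_le)
qed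

lemma SL2_card_neq_192:
  assumes "7 \<le> CARD('p :: prime_card)"
  shows "card (carrier (SL2 :: ('p mod_ring ^ 2 ^ 2) monoid)) \<noteq> 192"
proof -
  have "7 * 6 * 8 \<le> CARD('p) * (CARD('p) - 1) * (CARD('p) + 1)"
    using assms by (intro mult_le_mono) auto
  then show ?thesis unfolding card_SL2 by simp
qed

lemma powr_64: "64 powr (1 + (log 2 7 - 1) / 6) = (224 :: real)"
proof -
  let ?e = "1 + (log 2 7 - 1) / 6 :: real"
  have "(64 :: real) powr ?e = (2 powr 6) powr ?e" by simp
  also have "\<dots> = 2 powr (6 * ?e)" by (rule powr_powr)
  also have "6 * ?e = 5 + log 2 7" by (simp add: field_simps)
  also have "2 powr (5 + log 2 7) = (2 powr 5 :: real) * 2 powr (log 2 7)" by (rule powr_add)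
  also have "\<dots> = 224" by simp
  finally show ?thesis .
qed

theorem theorem6p3:
  fixes H S :: "('p::prime_card mod_ring ^ 2 ^ 2) set"
    and x :: "'p mod_ring ^ 2 ^ 2"
  assumes "subgroup H SL2"
    and "iso_2S4 H"
    and "x \<in> carrier SL2"
    and "S = plus_two_subset SL2 H x \<or>
         (x \<otimes>\<^bsub>SL2\<^esub> x \<in> H \<and> S = plus_coset_core SL2 H x)"
    and "generate SL2 S = carrier SL2"
  shows "let \<delta> = (log 2 7 - 1) / 6; L = conj_inter SL2 H x in
           card (set_cube SL2 S) \<ge> 224 \<and> card S \<le> 64 \<and>
           real (card (set_cube SL2 S)) \<ge> real (card S) powr (1 + \<delta>) \<and>
           (real (card (set_cube SL2 S)) = real (card S) powr (1 + \<delta>) \<longleftrightarrow>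
              subgroup_index SL2 H L = 3 \<and>
              S = H \<union> (x <#\<^bsub>SL2\<^esub> L) \<and>
              x \<otimes>\<^bsub>SL2\<^esub> x \<in> H)"
proof -
  note H = assms(1) and x = assms(3)
  interpret group "SL2 :: ('p mod_ring ^ 2 ^ 2) monoid" by (rule group_SL2)
  interpret H: subgroup H SL2 by fact
  define L where "L = conj_inter SL2 H x"
  define \<delta> :: real where "\<delta> = (log 2 7 - 1) / 6"
  have p: "7 \<le> CARD('p)" and cH: "card H = 48"
    using card_2S4_in_SL2[OF H assms(2)] by auto
  have fin: "finite (carrier (SL2 :: ('p mod_ring ^ 2 ^ 2) monoid))" by simp
  have L: "subgroup L SL2" unfolding L_def using H x by (rule subgroup_conj_inter)
  have LH: "L \<subseteq> H" by (auto simp: L_def conj_inter_def)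
  have S_cases: "S = H \<union> {x, inv\<^bsub>SL2\<^esub> x} \<or>
      (x \<otimes>\<^bsub>SL2\<^esub> x \<in> H \<and> S = H \<union> (x <#\<^bsub>SL2\<^esub> L))"
    using assms(4) unfolding plus_two_subset_def plus_coset_core_def coset_core_eq[OF H x] L_def .
  have S_sup: "H \<union> {x, inv\<^bsub>SL2\<^esub> x} \<subseteq> S"
  proof (cases "S = H \<union> {x, inv\<^bsub>SL2\<^esub> x}")
    case False
    then have xx: "x \<otimes>\<^bsub>SL2\<^esub> x \<in> H" and S: "S = H \<union> (x <#\<^bsub>SL2\<^esub> L)" using S_cases by auto
    have "x \<otimes>\<^bsub>SL2\<^esub> \<one>\<^bsub>SL2\<^esub> \<in> S"
      unfolding S l_coset_def using subgroup.one_closed[OF L] by blast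
    then have "x \<in> S" using x by simp
    moreover have "inv\<^bsub>SL2\<^esub> x \<in> S"
    proof -
      have eq: "x \<otimes>\<^bsub>SL2\<^esub> inv\<^bsub>SL2\<^esub> (x \<otimes>\<^bsub>SL2\<^esub> x) = inv\<^bsub>SL2\<^esub> x"
        using x by (simp add: inv_mult_group inv_cancel_left)
      have "inv\<^bsub>SL2\<^esub> (x \<otimes>\<^bsub>SL2\<^esub> x) \<in> L"
      proof -
        have "inv\<^bsub>SL2\<^esub> x \<otimes>\<^bsub>SL2\<^esub> inv\<^bsub>SL2\<^esub> x = inv\<^bsub>SL2\<^esub> (x \<otimes>\<^bsub>SL2\<^esub> x)"
          using x by (simp add: inv_mult_group)
        moreover have "inv\<^bsub>SL2\<^esub> (x \<otimes>\<^bsub>SL2\<^esub> x) \<in> H" using xx by (rule H.m_inv_closed)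
        ultimately show ?thesis unfolding L_def mem_conj_inter_iff[OF H x] eq by metis
      qed
      then have "x \<otimes>\<^bsub>SL2\<^esub> inv\<^bsub>SL2\<^esub> (x \<otimes>\<^bsub>SL2\<^esub> x) \<in> S" unfolding S l_coset_def by blast
      then show ?thesis unfolding eq .
    qed
    ultimately show ?thesis using S by auto
  qed simp
  have S_sub: "S \<subseteq> generate SL2 (insert x H)"
  proof -
    let ?M = "generate SL2 (insert x H)"
    have M: "x \<in> ?M" "inv\<^bsub>SL2\<^esub> x \<in> ?M" "H \<subseteq> ?M" by (auto intro: generate.intros)
    moreover have "x <#\<^bsub>SL2\<^esub> L \<subseteq> ?M"
      using M LH by (auto simp: l_coset_def intro: generate.eng)
    ultimately show ?thesis using S_cases by auto
  qed
  have xH_sub: "insert x H \<subseteq> carrier SL2" using x H.subset by auto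
  have "generate SL2 S \<subseteq> generate SL2 (insert x H)"
    using S_sub generate_is_subgroup[OF xH_sub] by (rule generate_subgroup_incl)
  then have gen: "generate SL2 (insert x H) = carrier SL2"
    using assms(5) generate_incl[OF xH_sub] by auto
  have SC: "S \<subseteq> carrier SL2" using S_sub gen by simp
  have no_normal: "card N \<notin> {16, 24, 48}" if "N \<lhd> SL2" for N :: "('p mod_ring ^ 2 ^ 2) set"
    using that p by (rule SL2_no_small_normal_subgroup)
  have cube: "224 \<le> card (set_cube SL2 S)"
    using card_set_cube_ge[OF fin H cH x gen no_normal SL2_card_neq_192[OF p] S_sup SC] .
  have H_gen: "generate SL2 H = H"
    using generate_subgroup_incl[OF _ H] generate.incl by (metis subset_antisym subsetI subset_refl)
  have xH: "x \<notin> H"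
  proof
    assume "x \<in> H"
    then have "carrier SL2 = H" using gen H_gen by (simp add: insert_absorb)
    then have "H \<lhd> SL2" using normal_self by metis
    then show False using no_normal cH by auto
  qed
  obtain k where k: "card H = k * card L" "subgroup_index SL2 H L = k"
    using subgroup_index_mult_card[OF L H LH] by metis
  have index_ge_3: "3 \<le> k" if xx: "x \<otimes>\<^bsub>SL2\<^esub> x \<in> H"
  proof (rule ccontr)
    assume "\<not> 3 \<le> k"
    moreover have "k \<noteq> 0" using k cH by (metis mult_0 zero_neq_numeral)
    ultimately have k12: "k = 1 \<or> k = 2" by linarith
    have "h \<otimes>\<^bsub>SL2\<^esub> l \<otimes>\<^bsub>SL2\<^esub> inv\<^bsub>SL2\<^esub> h \<in> L" if "h \<in> H" "l \<in> L" for h l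
      using k12
    proof
      assume "k = 1"
      then have "L = H" using k LH by (intro card_subset_eq) simp_all
      then show ?thesis using that by simp
    next
      assume "k = 2"
      then show ?thesis using index_2_normalised[OF fin H L LH] k that by simp
    qed
    then have "L \<lhd> SL2"
      unfolding L_def using normal_conj_inter[OF fin H x xx gen] by blast
    moreover have "card L \<in> {16, 24, 48}" using k(1) cH k12 by auto
    ultimately show False using no_normal by blast
  qed
  have card_core: "card (H \<union> (x <#\<^bsub>SL2\<^esub> L)) = 48 + card L"
    unfolding L_def using card_conj_inter_plus_core[OF fin H x xH] cH by simp
  have card_two: "card (H \<union> {x, inv\<^bsub>SL2\<^esub> x}) \<le> 50"
  proof -
    have "card (H \<union> {x, inv\<^bsub>SL2\<^esub> x}) \<le> card H + card {x, inv\<^bsub>SL2\<^esub> x}" by (rule card_Un_le)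
    also have "card {x, inv\<^bsub>SL2\<^esub> x} \<le> 2" by (simp add: card_insert_le_m1)
    finally show ?thesis using cH by simp
  qed
  have L16: "card L \<le> 16" if "x \<otimes>\<^bsub>SL2\<^esub> x \<in> H"
  proof -
    have "3 * card L \<le> k * card L" using index_ge_3[OF that] by (rule mult_le_mono1)
    then show ?thesis unfolding k(1)[symmetric] cH by simp
  qed
  have S64: "card S \<le> 64"
    using S_cases card_core card_two L16 by auto
  have mono: "real n powr (1 + \<delta>) \<le> real m powr (1 + \<delta>)" if "n \<le> m" for n m :: nat
    using that by (intro powr_mono2) (auto simp: \<delta>_def)
  have pow64: "real 64 powr (1 + \<delta>) = 224" using powr_64 by (simp add: \<delta>_def)
  have le: "real (card S) powr (1 + \<delta>) \<le> 224" using mono[OF S64] pow64 by simp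
  have "real (card (set_cube SL2 S)) = real (card S) powr (1 + \<delta>) \<longleftrightarrow>
      subgroup_index SL2 H L = 3 \<and> S = H \<union> (x <#\<^bsub>SL2\<^esub> L) \<and> x \<otimes>\<^bsub>SL2\<^esub> x \<in> H"
  proof
    assume eq: "real (card (set_cube SL2 S)) = real (card S) powr (1 + \<delta>)"
    have "card S = 64"
    proof (rule ccontr)
      assume "card S \<noteq> 64"
      then have "real (card S) powr (1 + \<delta>) < real 64 powr (1 + \<delta>)"
        using S64 by (intro powr_less_mono2) (auto simp: \<delta>_def add_pos_nonneg)
      then show False using eq cube pow64 by simp
    qed
    then have S: "x \<otimes>\<^bsub>SL2\<^esub> x \<in> H" "S = H \<union> (x <#\<^bsub>SL2\<^esub> L)"
      using S_cases card_two by auto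
    then have "card L = 16" using \<open>card S = 64\<close> card_core by simp
    then have "k = 3" using k(1) cH by simp
    then show "subgroup_index SL2 H L = 3 \<and> S = H \<union> (x <#\<^bsub>SL2\<^esub> L) \<and> x \<otimes>\<^bsub>SL2\<^esub> x \<in> H"
      using S k(2) by simp
  next
    assume R: "subgroup_index SL2 H L = 3 \<and> S = H \<union> (x <#\<^bsub>SL2\<^esub> L) \<and> x \<otimes>\<^bsub>SL2\<^esub> x \<in> H"
    then have k3: "card H = 3 * card L" using k by simp
    then have "card L = 16" using cH by simp
    then have "card (set_cube SL2 S) \<le> 224"
      using card_set_cube_le[OF fin H x] R k3 unfolding L_def by simp
    moreover have "card S = 64" using R card_core \<open>card L = 16\<close> by simp
    ultimately show "real (card (set_cube SL2 S)) = real (card S) powr (1 + \<delta>)"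
      using cube pow64 by simp
  qed
  then show ?thesis
    using cube S64 le unfolding Let_def L_def[symmetric] \<delta>_def[symmetric] by simp
qed

end
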